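(* If $G$ is a graph with $\operatorname{mad}(G)\le\frac{20}{7}$, then $\chi_{so}(G)\le \Delta(G)+4$.
   Context: All graphs are finite and simple. $\Delta(G)$ is the maximum degree of $G$, and $N_G(v)$ is the set of neighbors of $v$ in $G$. The maximum average degree $\operatorname{mad}(G)$ is the maximum of $\frac{2|E(H)|}{|V(H)|}$ over all non-empty subgraphs $H$ of $G$. For a positive integer $k$, a strong odd $k$-coloring of $G$ is a proper coloring of $G$ with colors in $\{1,\ldots,k\}$ (adjacent vertices receive different colors) such that for every non-isolated vertex $v$, if a color appears in $N_G(v)$, then it appears on an odd number of vertices of $N_G(v)$. The strong odd chromatic number $\chi_{so}(G)$ is the minimum $k$ such that $G$ has a strong odd $k$-coloring. *)

theory Defs
  imports Complex_Main "Graph_Theory.Graph_Theory"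
begin

text \<open>
  A finite simple graph is a \<^locale>\<open>pair_graph\<close>: finite vertex set, irreflexive symmetric
  set of arcs.  Each undirected edge \<open>uv\<close> thus occurs as the two arcs \<open>(u, v)\<close> and \<open>(v, u)\<close>,
  so edges are counted as unordered pairs.
\<close>

definition edges :: "'a pair_pre_digraph \<Rightarrow> 'a set set" where
  "edges G = {{u, v} | u v. (u, v) \<in> parcs G}"

definition nbrs :: "'a pair_pre_digraph \<Rightarrow> 'a \<Rightarrow> 'a set" where
  "nbrs G v = {u. (v, u) \<in> parcs G}"

text \<open>
  For the graph without vertices, the next two maxima range over the empty set and hence are
  unspecified.
\<close>

definition max_degree :: "'a pair_pre_digraph \<Rightarrow> nat" where
  "max_degree G = Max ((\<lambda>v. card (nbrs G v)) ` pverts G)"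

definition mad :: "'a pair_pre_digraph \<Rightarrow> real" where
  "mad G = Max {2 * real (card (edges H)) / real (card (pverts H)) | H.
     pair_graph H \<and> subgraph H G \<and> pverts H \<noteq> {}}"

definition proper_coloring :: "'a pair_pre_digraph \<Rightarrow> nat \<Rightarrow> ('a \<Rightarrow> nat) \<Rightarrow> bool" where
  "proper_coloring G k c \<longleftrightarrow>
     c ` pverts G \<subseteq> {1..k} \<and> (\<forall>(u, v) \<in> parcs G. c u \<noteq> c v)"

definition strong_odd_coloring :: "'a pair_pre_digraph \<Rightarrow> nat \<Rightarrow> ('a \<Rightarrow> nat) \<Rightarrow> bool" where
  "strong_odd_coloring G k c \<longleftrightarrow>
     proper_coloring G k c \<and>
     (\<forall>v \<in> pverts G. nbrs G v \<noteq> {} \<longrightarrow>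
        (\<forall>i \<in> c ` nbrs G v. odd (card {u \<in> nbrs G v. c u = i})))"

definition strong_odd_chromatic_number :: "'a pair_pre_digraph \<Rightarrow> nat" where
  "strong_odd_chromatic_number G = (LEAST k. 0 < k \<and> (\<exists>c. strong_odd_coloring G k c))"

text \<open>
  The maximum in \<^const>\<open>mad\<close> and the minimum in \<^const>\<open>strong_odd_chromatic_number\<close>
  are attained.
\<close>

lemma (in pair_graph) finite_mad_set:
  "finite {2 * real (card (edges H)) / real (card (pverts H)) | H.
     pair_graph H \<and> subgraph H G \<and> pverts H \<noteq> {}}"
proof -
  let ?f = "\<lambda>H. 2 * real (card (edges H)) / real (card (pverts H))"
  let ?S = "(\<lambda>(V, A). \<lparr>pverts = V, parcs = A\<rparr>) ` (Pow (pverts G) \<times> Pow (parcs G))"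
  have "{?f H | H. pair_graph H \<and> subgraph H G \<and> pverts H \<noteq> {}} \<subseteq> ?f ` ?S"
  proof
    fix x assume "x \<in> {?f H | H. pair_graph H \<and> subgraph H G \<and> pverts H \<noteq> {}}"
    then obtain H where H: "x = ?f H" "subgraph H G" by blast
    then have "(pverts H, parcs H) \<in> Pow (pverts G) \<times> Pow (parcs G)"
      by (auto simp: subgraph_def)
    moreover have "H = (\<lambda>(V, A). \<lparr>pverts = V, parcs = A\<rparr>) (pverts H, parcs H)" by simp
    ultimately have "H \<in> ?S" by (rule rev_image_eqI)
    then show "x \<in> ?f ` ?S" using H(1) by (rule rev_image_eqI)
  qed
  moreover have "finite (?f ` ?S)"
    using pair_finite_verts pair_finite_arcs by blast
  ultimately show ?thesis by (rule finite_subset)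
qed

lemma (in pair_graph) mad_set_nonempty:
  assumes "pverts G \<noteq> {}"
  shows "{2 * real (card (edges H)) / real (card (pverts H)) | H.
     pair_graph H \<and> subgraph H G \<and> pverts H \<noteq> {}} \<noteq> {}"
proof -
  have "subgraph G G" by (simp add: subgraph_def compatible_def wf_digraph)
  with assms pair_graph_axioms show ?thesis by blast
qed

lemma (in pair_graph) strong_odd_coloring_exists:
  "\<exists>k c. 0 < k \<and> strong_odd_coloring G k c"
proof -
  obtain f where f: "bij_betw f (pverts G) {1..card (pverts G)}"
    using finite_same_card_bij[OF pair_finite_verts, of "{1..card (pverts G)}"] by auto
  then have inj: "inj_on f (pverts G)" by (rule bij_betw_imp_inj_on)
  have "strong_odd_coloring G (Suc (card (pverts G))) f"
    unfolding strong_odd_coloring_def proper_coloring_def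
  proof (intro conjI ballI impI)
    show "f ` pverts G \<subseteq> {1..Suc (card (pverts G))}"
      using f by (auto simp: bij_betw_def)
  next
    fix e assume "e \<in> parcs G"
    then show "case e of (u, v) \<Rightarrow> f u \<noteq> f v"
      using inj pair_no_loops wellformed' by (fastforce dest: inj_onD)
  next
    fix v i assume "i \<in> f ` nbrs G v"
    then obtain w where w: "w \<in> nbrs G v" "i = f w" by blast
    have "{u \<in> nbrs G v. f u = i} = {w}"
      using w inj by (auto simp: nbrs_def dest: inj_onD in_arcsD2)
    then show "odd (card {u \<in> nbrs G v. f u = i})" by simp
  qed
  then show ?thesis by blast
qed

end

theory Submission
  imports Defs
begin

text \<open>
Fix \<open>D\<close> and consider graphs of maximum degree at most \<open>D\<close> in which every vertex set \<open>S\<close> satisfies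
\<open>7 * (sum of the degrees inside S) \<le> 20 * |S|\<close>; this is what \<open>mad \<le> 20/7\<close> says about induced
subgraphs, and it is inherited by them.  A smallest such graph without a strong odd colouring in
\<open>D + 4\<close> colours (the locale \<open>critical_graph\<close>) is refuted by reducible configurations and discharging.

\<^emph>\<open>Reducibility.\<close>  Delete a set \<open>U\<close> in which every vertex has at most one neighbour outside \<open>U\<close>.  By
minimality the rest has a strong odd colouring, and each colour then occurs an odd number of times or
not at all around \<^emph>\<open>every\<close> vertex of the graph, the deleted ones included.  This invariant (\<open>partial\<close>)
survives when a deleted vertex receives a colour that no coloured vertex within distance two of it
has.  A neighbour \<open>w\<close> of \<open>u\<close> is responsible for at most \<open>d w\<close> forbidden colours at \<open>u\<close>, and for fewer
while vertices around \<open>w\<close> are still uncoloured; so a suitable order of \<open>U\<close> often allows a greedy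
completion.  Recolouring instead of deleting would not do: a vertex that gives up a colour occurring
three times around a neighbour leaves an even multiplicity behind.

Where greedy counting fails by a little, the freedom in the definition helps: a colour may be used
three times around one vertex.  It enters in \<open>odd_choosable_large_lists\<close> (lists that are too short
for a rainbow choice still allow a choice in which every colour has odd multiplicity), in
\<open>extend_pair\<close> (two vertices may both repeat the colour of a third neighbour), and in
\<open>path_equal_lists\<close>.  The outcome, for a 3-vertex called \<open>bad\<close> if it has a neighbour of degree 2:
all degrees are at least 2; 2-vertices are pairwise non-adjacent; a 3-vertex has at most one, a
4-vertex at most two, and a 5-vertex at most four neighbours of degree 2; bad vertices are pairwise
non-adjacent; a 3-vertex has at most one bad neighbour.

\<^emph>\<open>Discharging.\<close>  Give each vertex the charge \<open>7 d - 20\<close>, so that the total is at most 0.  Each vertex of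
degree at least 3 sends 3 to each neighbour of degree 2 and 1 to each bad neighbour.  By the facts
above no final charge is negative (\<open>charge_nonneg\<close>), hence all of them are 0.

\<^emph>\<open>The case of equality.\<close>  Charge 0 and the bound for 5-vertices exclude degrees
above 4.  A 4-vertex would have exactly two
neighbours of degree 2 and two bad ones, which is reducible (\<open>four_vertex_reducible\<close>).  So all degrees
are 2 or 3, and every 3-vertex that is not bad has exactly one bad neighbour.  Consider the at most
seven vertices within distance two of a 2-vertex.  If no edge leaves this set, it is coloured
injectively (\<open>small_component_reducible\<close>).  Otherwise a leaving edge is the middle of a path that
joins two 2-vertices through four 3-vertices, and such a path is reducible (\<open>path_reducible\<close>).
\<close>

section \<open>Colour patterns in which every colour occurs an odd number of times\<close>

definition odd_on :: "('a \<Rightarrow> 'c) \<Rightarrow> 'a set \<Rightarrow> bool" where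
  "odd_on c A \<longleftrightarrow> (\<forall>i \<in> c ` A. odd (card {u \<in> A. c u = i}))"

lemma odd_on_inj:
  assumes "inj_on c A"
  shows "odd_on c A"
  unfolding odd_on_def
proof
  fix i assume "i \<in> c ` A"
  then obtain a where "a \<in> A" "i = c a" by blast
  then have "{u \<in> A. c u = i} = {a}" using assms by (auto dest: inj_onD)
  then show "odd (card {u \<in> A. c u = i})" by simp
qed

lemma odd_on_const:
  assumes "\<And>u. u \<in> A \<Longrightarrow> c u = p" "odd (card A)"
  shows "odd_on c A"
  unfolding odd_on_def
proof
  fix i assume "i \<in> c ` A"
  then have "{u \<in> A. c u = i} = A" using assms(1) by force
  then show "odd (card {u \<in> A. c u = i})" using assms(2) by simp
qed

lemma disjoint_images:
  assumes "\<And>u. u \<in> A \<Longrightarrow> c u = p" "\<And>u. u \<in> B \<Longrightarrow> c u \<noteq> p"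
  shows "c ` A \<inter> c ` B = {}"
proof -
  have "c ` A \<subseteq> {p}" using assms(1) by auto
  moreover have "p \<notin> c ` B" using assms(2) by auto
  ultimately show ?thesis by auto
qed

lemma odd_on_cong: "(\<And>x. x \<in> A \<Longrightarrow> f x = g x) \<Longrightarrow> odd_on f A \<longleftrightarrow> odd_on g A"
proof -
  assume a: "\<And>x. x \<in> A \<Longrightarrow> f x = g x"
  then have "f ` A = g ` A" "\<And>i. {u\<in>A. f u = i} = {u\<in>A. g u = i}" by auto
  then show ?thesis unfolding odd_on_def by simp
qed

lemma odd_on_Un:
  assumes "odd_on f A" "odd_on f B" "f ` A \<inter> f ` B = {}"
  shows "odd_on f (A \<union> B)"
  unfolding odd_on_def
proof
  fix i assume i: "i \<in> f ` (A \<union> B)"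
  show "odd (card {u \<in> A \<union> B. f u = i})"
  proof (cases "i \<in> f ` A")
    case True
    then have "{u \<in> A \<union> B. f u = i} = {u \<in> A. f u = i}" using assms(3) by blast
    then show ?thesis using assms(1) True by (auto simp: odd_on_def)
  next
    case False
    then have "{u \<in> A \<union> B. f u = i} = {u \<in> B. f u = i}" by blast
    then show ?thesis using assms(2) False i by (auto simp: odd_on_def)
  qed
qed

lemma odd_on_pair: "odd_on c {p, q} \<Longrightarrow> p \<noteq> q \<Longrightarrow> c p \<noteq> c q"
proof
  assume o: "odd_on c {p, q}" and ne: "p \<noteq> q" and eq: "c p = c q"
  have "{u \<in> {p, q}. c u = c p} = {p, q}" using eq by auto
  then have "card {u \<in> {p, q}. c u = c p} = 2" using ne by simp
  moreover have "odd (card {u \<in> {p, q}. c u = c p})" using o unfolding odd_on_def by blast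
  ultimately show False by simp
qed

section \<open>Choosing colours from lists with odd multiplicities\<close>

text \<open>
In the application the indices are the uncoloured neighbours of one vertex, \<open>L i\<close> is the list of colours available at \<open>i\<close>,
and \<open>g\<close> maps \<open>i\<close> to its second neighbour.  Indices with the same second neighbour need distinct colours,
because that neighbour sees both of them.
\<close>
definition odd_choosable :: "('i \<Rightarrow> 'b) \<Rightarrow> ('i \<Rightarrow> 'c set) \<Rightarrow> 'i set \<Rightarrow> bool" where
  "odd_choosable g L I \<longleftrightarrow> (\<exists>f. (\<forall>i\<in>I. f i \<in> L i) \<and>
     (\<forall>i\<in>I. \<forall>j\<in>I. i \<noteq> j \<and> g i = g j \<longrightarrow> f i \<noteq> f j) \<and> odd_on f I)"

text \<open>
A colour \<open>\<beta>\<close> used on an odd number of indices, at most one from each class of \<open>g\<close>, is finished once it is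
removed from all other lists.  This is the induction step of the next lemma.
\<close>
lemma odd_choosable_extend:
  assumes "odd_choosable g (\<lambda>i. L i - {\<beta>}) (I - R)"
    and "R \<subseteq> I" "odd (card R)" "inj_on g R" "\<forall>i\<in>R. \<beta> \<in> L i"
  shows "odd_choosable g L I"
proof -
  obtain f where f: "\<forall>i\<in>I-R. f i \<in> L i - {\<beta>}"
    "\<forall>i\<in>I-R. \<forall>j\<in>I-R. i \<noteq> j \<and> g i = g j \<longrightarrow> f i \<noteq> f j" "odd_on f (I-R)"
    using assms(1) unfolding odd_choosable_def by blast
  let ?f = "\<lambda>i. if i \<in> R then \<beta> else f i"
  have "odd (card {u \<in> I. ?f u = i})" if i: "i \<in> ?f ` I" for i
  proof (cases "i = \<beta>")
    case True
    then have "{u \<in> I. ?f u = i} = R" using f(1) assms(2) by auto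
    then show ?thesis using assms(3) by simp
  next
    case False
    then have "{u \<in> I. ?f u = i} = {u \<in> I - R. f u = i}" by auto
    moreover have "i \<in> f ` (I - R)" using i False by (auto split: if_splits)
    ultimately show ?thesis using f(3) by (auto simp: odd_on_def)
  qed
  then have "odd_on ?f I" by (simp add: odd_on_def)
  moreover have "\<forall>i\<in>I. ?f i \<in> L i" using f(1) assms(5) by auto
  moreover have "\<forall>i\<in>I. \<forall>j\<in>I. i \<noteq> j \<and> g i = g j \<longrightarrow> ?f i \<noteq> ?f j"
  proof (intro ballI impI)
    fix i j assume ij: "i \<in> I" "j \<in> I" "i \<noteq> j \<and> g i = g j"
    show "?f i \<noteq> ?f j"
    proof (cases "i \<in> R"; cases "j \<in> R")
      assume "i \<in> R" "j \<in> R"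
      then show ?thesis using assms(4) ij(3) by (auto dest: inj_onD)
    next
      assume "i \<in> R" "j \<notin> R" then show ?thesis using f(1) ij by auto
    next
      assume "i \<notin> R" "j \<in> R" then show ?thesis using f(1) ij by auto
    next
      assume "i \<notin> R" "j \<notin> R" then show ?thesis using f(2) ij by auto
    qed
  qed
  ultimately show ?thesis unfolding odd_choosable_def by (intro exI[of _ ?f]) blast
qed

text \<open>
Lists of about half the number of indices suffice, because one colour can serve an odd number of
indices at once.  Let \<open>n\<close> be the number of \<open>g\<close>-classes in which \<open>\<beta>\<close> is available, and use \<open>\<beta>\<close> once in
each of these classes if \<open>n\<close> is odd, and in all but one of them if \<open>n\<close> is even.  A list that loses \<open>\<beta>\<close>
without belonging to a class just used is paid for by the decrease of \<open>card I div 2\<close>.  This decrease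
fails only for \<open>n = 2\<close> and odd \<open>card I\<close>; then two colours are used on one index each, and both
bounds drop together.
\<close>
lemma odd_choosable_large_lists:
  assumes "finite I" "\<And>i. i \<in> I \<Longrightarrow> finite (L i)"
    and "\<And>i. i \<in> I \<Longrightarrow> card I div 2 + card {j\<in>I. g j = g i} \<le> card (L i)"
  shows "odd_choosable g L I"
  using assms
proof (induction "card I" arbitrary: I L rule: less_induct)
  case less
  note fin = less.prems(1) and finL = less.prems(2) and big = less.prems(3)
  let ?A = "\<lambda>\<beta>. {i\<in>I. \<beta> \<in> L i}"
  have class_pos: "0 < card {j\<in>I. g j = g i}" if "i \<in> I" for i
    using that fin by (auto simp: card_gt_0_iff)
  have reduce: "odd_choosable g L I"
    if R: "R \<subseteq> ?A \<beta>" "inj_on g R" "odd (card R)"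
      and rest: "g ` R = g ` ?A \<beta> \<or> (card I - card R) div 2 < card I div 2" for R \<beta>
  proof (rule odd_choosable_extend[of g L \<beta> I R])
    have RI: "R \<subseteq> I" using R(1) by auto
    then have finR: "finite R" using fin finite_subset by blast
    have cR: "card (I - R) = card I - card R" using RI finR by (simp add: card_Diff_subset)
    have "R \<noteq> {}" using R(3) by auto
    then have posR: "0 < card R" "card R \<le> card I"
      using finR RI fin by (auto simp: card_gt_0_iff card_mono)
    show "odd_choosable g (\<lambda>i. L i - {\<beta>}) (I - R)"
    proof (rule less.hyps)
      show "card (I - R) < card I" using cR posR by simp
      show "finite (I - R)" using fin by simp
      show "finite (L i - {\<beta>})" if "i \<in> I - R" for i using finL that by simp
      fix i assume i: "i \<in> I - R"
      let ?C = "{j\<in>I. g j = g i}" and ?C' = "{j\<in>I-R. g j = g i}"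
      have le: "card ?C' \<le> card ?C" using fin by (intro card_mono) auto
      have lt: "card ?C' < card ?C" if "g i \<in> g ` R"
        using fin that RI by (intro psubset_card_mono) auto
      have cL: "card (L i) \<le> card (L i - {\<beta>}) + (if \<beta> \<in> L i then 1 else 0)"
        using finL[of i] i by (auto simp: card_Diff_singleton)
      have dv: "card (I - R) div 2 \<le> card I div 2" using cR by (simp add: div_le_mono)
      have b: "card I div 2 + card ?C \<le> card (L i)" using big[of i] i by simp
      show "card (I - R) div 2 + card ?C' \<le> card (L i - {\<beta>})"
      proof (cases "\<beta> \<in> L i")
        case False
        then show ?thesis using cL dv b le by simp
      next
        case True
        then have "g i \<in> g ` ?A \<beta>" using i by auto
        have "card (L i) \<le> Suc (card (L i - {\<beta>}))" using cL True by simp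
        moreover have "card ?C' < card ?C \<or> card (I - R) div 2 < card I div 2"
          using rest lt cR \<open>g i \<in> g ` ?A \<beta>\<close> by auto
        ultimately show ?thesis using le dv b by linarith
      qed
    qed
  qed (use R in auto)
  show ?case
  proof (cases "I = {}")
    case True
    then show ?thesis by (simp add: odd_choosable_def odd_on_def)
  next
    case False
    then obtain i where i: "i \<in> I" by blast
    have "0 < card (L i)" using big[OF i] class_pos[OF i] by simp
    then obtain \<beta> where \<beta>: "\<beta> \<in> L i" by (auto simp: card_gt_0_iff)
    let ?n = "card (g ` ?A \<beta>)"
    have finA: "finite (g ` ?A \<beta>)" using fin by simp
    have giA: "g i \<in> g ` ?A \<beta>" using i \<beta> by auto
    have npos: "0 < ?n" using giA finA by (auto simp: card_gt_0_iff)
    have cases_n: "odd n \<or> (even n \<and> (4 \<le> n \<or> even m)) \<or> (n = 2 \<and> odd m)" if "0 < n" for n m :: nat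
      using that by presburger
    \<comment> \<open>In the middle case all but one class can be used: then \<open>card I div 2\<close> drops, since either three or more indices are used, or an even number of indices becomes smaller.\<close>
    consider (odd) "odd ?n" | (even) "even ?n" "?n \<ge> 4 \<or> even (card I)"
      | (two) "?n = 2" "odd (card I)"
      using cases_n[OF npos, of "card I"] by fast
    then show ?thesis
    proof cases
      case odd
      obtain R where R: "R \<subseteq> ?A \<beta>" "inj_on g R" "g ` ?A \<beta> = g ` R"
        using subset_image_inj[of "g ` ?A \<beta>" g "?A \<beta>"] by auto
      show ?thesis using reduce[OF R(1,2)] R(3) odd card_image[OF R(2)] by simp
    next
      case even
      obtain R where R: "R \<subseteq> ?A \<beta>" "inj_on g R" "g ` ?A \<beta> - {g i} = g ` R"
        using subset_image_inj[of "g ` ?A \<beta> - {g i}" g "?A \<beta>"] by auto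
      have cR: "card R = ?n - 1" using card_image[OF R(2)] R(3) giA finA by (metis card_Diff_singleton)
      have "R \<subseteq> I" using R(1) by auto
      then have "card R \<le> card I" using fin by (simp add: card_mono)
      moreover have "odd (card R)" using cR even(1) npos by simp
      moreover have "(card I - card R) div 2 < card I div 2"
        using even(2)
      proof
        assume "4 \<le> ?n"
        then show ?thesis using cR \<open>card R \<le> card I\<close> by linarith
      next
        assume "even (card I)"
        then show ?thesis using \<open>odd (card R)\<close> \<open>card R \<le> card I\<close>
          by presburger
      qed
      ultimately show ?thesis using reduce[OF R(1,2)] by blast
    next
      case two
      have "card (g ` ?A \<beta> - {g i}) = 1" using two(1) giA finA by (simp add: card_Diff_singleton)
      then obtain b where b: "g ` ?A \<beta> - {g i} = {b}" by (auto simp: card_1_singleton_iff)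
      then have groups: "g ` ?A \<beta> = {g i, b}" "b \<noteq> g i" using giA by auto
      \<comment> \<open>The classes of \<open>i\<close> and \<open>j\<close> are the only ones that contain \<open>\<beta>\<close>.  Use \<open>\<beta>\<close> for \<open>i\<close> and another colour \<open>\<gamma>\<close> for \<open>j\<close>: outside these two classes only \<open>\<gamma>\<close> can be lost, inside them each class has become smaller by one.\<close>
      then obtain j where j: "j \<in> I" "\<beta> \<in> L j" "g j = b"
      proof -
        have "b \<in> g ` ?A \<beta>" using groups(1) by (metis insertI1 insert_commute)
        then show ?thesis using that by auto
      qed
      have ij: "j \<noteq> i" "g i \<noteq> g j" using groups j by auto
      have "card {i,j} \<le> card I" using i j fin by (intro card_mono) auto
      then have m: "2 \<le> card I" using ij by simp
      have "2 \<le> card (L j)" using big[OF j(1)] class_pos[OF j(1)] m by linarith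
      then have "0 < card (L j - {\<beta>})" using j(2) by (simp add: card_Diff_singleton)
      then obtain \<gamma> where \<gamma>: "\<gamma> \<in> L j - {\<beta>}" by (auto simp: card_gt_0_iff)
      have "odd_choosable g (\<lambda>l. L l - {\<beta>} - {\<gamma>}) (I - {i} - {j})"
      proof (rule less.hyps)
        have cI: "card (I - {i} - {j}) = card I - 2" using i j ij fin by (simp add: card_Diff_singleton)
        then show "card (I - {i} - {j}) < card I" using m by simp
        show "finite (I - {i} - {j})" using fin by simp
        show "finite (L l - {\<beta>} - {\<gamma>})" if "l \<in> I - {i} - {j}" for l using finL that by simp
        fix l assume l: "l \<in> I - {i} - {j}"
        let ?C = "{h\<in>I. g h = g l}" and ?C' = "{h\<in>I-{i}-{j}. g h = g l}"
        have le: "card ?C' \<le> card ?C" using fin by (intro card_mono) auto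
        have lt: "card ?C' < card ?C" if "g l = g i \<or> g l = g j"
        proof (rule psubset_card_mono)
          have "g i = g l \<or> g j = g l" using that by metis
          then have "i \<in> ?C - ?C' \<or> j \<in> ?C - ?C'" using i j(1) by simp
          then show "?C' \<subset> ?C" by blast
        qed (use fin in simp)
        have f: "finite (L l)" using finL l by simp
        have c1: "card (L l) \<le> card (L l - {\<beta>}) + (if \<beta> \<in> L l then 1 else 0)"
          using f by (auto simp: card_Diff_singleton)
        have c2: "card (L l - {\<beta>}) \<le> card (L l - {\<beta>} - {\<gamma>}) + 1"
          using f by (auto simp: card_Diff_singleton_if)
        have dv: "card (I - {i} - {j}) div 2 + 1 = card I div 2" using cI m by linarith
        have "\<beta> \<in> L l \<Longrightarrow> g l \<in> g ` ?A \<beta>" using l by auto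
        then have "\<beta> \<in> L l \<Longrightarrow> g l = g i \<or> g l = g j" using groups j by auto
        then have "card ?C' + card (L l) \<le> card ?C + card (L l - {\<beta>})"
          using c1 le lt by (cases "g l = g i \<or> g l = g j") (auto split: if_splits)
        moreover have "card I div 2 + card ?C \<le> card (L l)" using big l by simp
        ultimately show "card (I - {i} - {j}) div 2 + card ?C' \<le> card (L l - {\<beta>} - {\<gamma>})"
          using c2 dv by linarith
      qed
      then have "odd_choosable g (\<lambda>l. L l - {\<beta>}) (I - {i})"
        by (rule odd_choosable_extend) (use j \<gamma> ij in auto)
      then show ?thesis
        by (rule odd_choosable_extend) (use i \<beta> in auto)
    qed
  qed
qed

lemma two_elems: "2 \<le> card A \<Longrightarrow> \<exists>x\<in>A. \<exists>y\<in>A. x \<noteq> y"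
proof -
  assume a: "2 \<le> card A"
  then obtain B where "B \<subseteq> A" "card B = 2" using obtain_subset_with_card_n by metis
  then show ?thesis by (auto simp: card_2_iff)
qed

text \<open>
\<open>L\<close>, \<open>A\<close>, \<open>P\<close>, \<open>R\<close> are the lists along a path in which, except for its two ends, any two of the four
vertices need distinct colours.  Each end excludes at most one unordered pair of colours for the two inner
vertices, and the inner lists offer three such pairs unless they are equal and of size 2.
\<close>
lemma square_path_lists:
  assumes fin: "finite A" "finite P" "finite L" "finite R"
    and two: "2 \<le> card A" "2 \<le> card P" "2 \<le> card L" "2 \<le> card R"
  shows "(\<exists>\<alpha>\<in>A. \<exists>\<pi>\<in>P. \<exists>\<beta>\<in>L. \<exists>\<gamma>\<in>R. \<alpha> \<noteq> \<pi> \<and> \<beta> \<notin> {\<alpha>, \<pi>} \<and> \<gamma> \<notin> {\<alpha>, \<pi>}) \<or>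
    (card A = 2 \<and> P = A \<and> (L = A \<or> R = A))"
proof (cases "card A = 2 \<and> P = A")
  case True
  show ?thesis
  proof (cases "L = A \<or> R = A")
    case False
    obtain \<alpha> \<pi> where A: "A = {\<alpha>, \<pi>}" "\<alpha> \<noteq> \<pi>" using True by (auto simp: card_2_iff)
    have "\<not> L \<subseteq> A" "\<not> R \<subseteq> A" using False True two fin by (metis card_seteq)+
    then obtain \<beta> \<gamma> where "\<beta> \<in> L" "\<beta> \<notin> A" "\<gamma> \<in> R" "\<gamma> \<notin> A" by blast
    then show ?thesis using A True by blast
  qed (use True in simp)
next
  case False
  have "\<exists>a\<in>A. \<exists>a'\<in>A. \<exists>p\<in>P. \<exists>p'\<in>P. a \<noteq> a' \<and> p \<noteq> p' \<and> {a, a'} \<noteq> {p, p'}"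
  proof -
    obtain a a' where a: "a \<in> A" "a' \<in> A" "a \<noteq> a'" using two_elems[OF two(1)] by blast
    obtain p p' where p: "p \<in> P" "p' \<in> P" "p \<noteq> p'" using two_elems[OF two(2)] by blast
    show ?thesis
    proof (cases "A = {a, a'}")
      case True
      then have "card A = 2" using a by simp
      then have "P \<noteq> A" using False by simp
      then have "\<not> P \<subseteq> A" using card_seteq[OF fin(1), of P] two(2) \<open>card A = 2\<close> by auto
      then obtain p3 where "p3 \<in> P" "p3 \<notin> A" by blast
      moreover have "p \<noteq> p3 \<or> p' \<noteq> p3" using p by blast
      ultimately show ?thesis using a p True by blast
    next
      case False
      then obtain a3 where "a3 \<in> A" "a3 \<noteq> a" "a3 \<noteq> a'" using a by blast
      moreover have "{a, a'} \<noteq> {p, p'} \<or> {a, a3} \<noteq> {p, p'}"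
        using calculation a(3) by (auto simp: doubleton_eq_iff)
      ultimately show ?thesis using a p by blast
    qed
  qed
  then obtain a a' p p' where ap: "a \<in> A" "a' \<in> A" "p \<in> P" "p' \<in> P" "a \<noteq> a'" "p \<noteq> p'"
    and "{a, a'} \<noteq> {p, p'}" by blast
  then have sets: "\<not> (a = p \<and> a' = p' \<or> a = p' \<and> a' = p)" by auto
  obtain l l' where l: "l \<in> L" "l' \<in> L" "l \<noteq> l'" using two_elems[OF two(3)] by blast
  obtain r r' where r: "r \<in> R" "r' \<in> R" "r \<noteq> r'" using two_elems[OF two(4)] by blast
  have "\<exists>\<alpha>\<in>{a,a'}. \<exists>\<pi>\<in>{p,p'}. \<alpha> \<noteq> \<pi> \<and> (\<exists>\<beta>\<in>{l,l'}. \<beta> \<notin> {\<alpha>,\<pi>}) \<and> (\<exists>\<gamma>\<in>{r,r'}. \<gamma> \<notin> {\<alpha>,\<pi>})"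
    using ap(5,6) sets l(3) r(3) by simp auto
  then obtain \<alpha> \<pi> \<beta> \<gamma> where w: "\<alpha> \<in> {a,a'}" "\<pi> \<in> {p,p'}" "\<beta> \<in> {l,l'}" "\<gamma> \<in> {r,r'}"
    "\<alpha> \<noteq> \<pi>" "\<beta> \<notin> {\<alpha>,\<pi>}" "\<gamma> \<notin> {\<alpha>,\<pi>}" by blast
  have "\<alpha> \<in> A" "\<pi> \<in> P" "\<beta> \<in> L" "\<gamma> \<in> R" using w(1-4) ap(1-4) l(1,2) r(1,2) by auto
  with w(5-7) show ?thesis by (intro disjI1 bexI conjI)
qed

section \<open>Partial colourings of a minimal counterexample\<close>

text \<open>
The set \<open>T\<close> on which odd multiplicities are required is kept apart from the coloured set \<open>S\<close>: for
\<open>T = S\<close> this is a strong odd colouring of the subgraph induced by \<open>S\<close>, and during an extension \<open>T\<close>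
contains the uncoloured vertices as well.
\<close>
definition partial_coloring ::
    "('a \<Rightarrow> 'a \<Rightarrow> bool) \<Rightarrow> nat \<Rightarrow> 'a set \<Rightarrow> 'a set \<Rightarrow> ('a \<Rightarrow> nat) \<Rightarrow> bool" where
  "partial_coloring adj k T S c \<longleftrightarrow> c ` S \<subseteq> {1..k} \<and> (\<forall>u\<in>S. \<forall>v\<in>S. adj u v \<longrightarrow> c u \<noteq> c v) \<and>
     (\<forall>v\<in>T. odd_on c {u\<in>S. adj v u})"

locale critical_graph =
  fixes V :: "'a set" and adj :: "'a \<Rightarrow> 'a \<Rightarrow> bool" and D :: nat
  assumes fin: "finite V"
    and adj_sym: "adj u v \<Longrightarrow> adj v u"
    and adj_irrefl: "\<not> adj v v"
    and degree_le: "v \<in> V \<Longrightarrow> card {u\<in>V. adj v u} \<le> D"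
    and smaller_colorable:
      "U \<subseteq> V \<Longrightarrow> U \<noteq> {} \<Longrightarrow> \<exists>c. partial_coloring adj (D + 4) (V - U) (V - U) c"
    and not_colorable: "\<not> (\<exists>c. partial_coloring adj (D + 4) V V c)"
begin

definition N :: "'a \<Rightarrow> 'a set" where "N v = {u\<in>V. adj v u}"

definition d :: "'a \<Rightarrow> nat" where "d v = card (N v)"

definition partial :: "'a set \<Rightarrow> ('a \<Rightarrow> nat) \<Rightarrow> bool" where
  "partial S c \<longleftrightarrow> S \<subseteq> V \<and> partial_coloring adj (D + 4) V S c"

lemma finite_N [simp]: "finite (N v)" using fin by (simp add: N_def)

lemma N_sub: "N v \<subseteq> V" by (auto simp: N_def)

lemma N_sym: "u \<in> V \<Longrightarrow> v \<in> N u \<Longrightarrow> u \<in> N v" by (auto simp: N_def adj_sym)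

lemma N_irrefl [simp]: "v \<notin> N v" by (simp add: N_def adj_irrefl)

lemma d_le: "v \<in> V \<Longrightarrow> d v \<le> D" using degree_le by (simp add: d_def N_def)

lemma nbrs_2:
  assumes "d u = 2" "v \<in> N u"
  obtains x where "N u = {v, x}" "x \<noteq> v"
proof -
  have "card (N u - {v}) = 1" using assms by (simp add: d_def card_Diff_singleton)
  then obtain x where "N u - {v} = {x}" by (auto simp: card_1_singleton_iff)
  then have "N u = {v, x}" "x \<noteq> v" using assms(2) by auto
  then show ?thesis by (rule that)
qed

lemma nbrs_3:
  assumes "d u = 3" "v \<in> N u"
  obtains x y where "N u = {v, x, y}" "x \<noteq> v" "y \<noteq> v" "x \<noteq> y"
proof -
  have "card (N u - {v}) = 2" using assms by (simp add: d_def card_Diff_singleton)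
  then obtain x y where "N u - {v} = {x, y}" "x \<noteq> y" by (auto simp: card_2_iff)
  then have "N u = {v, x, y}" "x \<noteq> v" "y \<noteq> v" "x \<noteq> y" using assms(2) by auto
  then show ?thesis by (rule that)
qed

lemma nbrs_inside: "S \<subseteq> V \<Longrightarrow> {u\<in>S. adj v u} = N v \<inter> S" by (auto simp: N_def)

lemma partial_iff: "partial S c \<longleftrightarrow> S \<subseteq> V \<and> c ` S \<subseteq> {1..D+4} \<and> (\<forall>u\<in>S. \<forall>v\<in>S. adj u v \<longrightarrow> c u \<noteq> c v) \<and>
    (\<forall>v\<in>V. odd_on c (N v \<inter> S))"
  by (auto simp: partial_def partial_coloring_def nbrs_inside)

lemma not_partial_V: "\<not> partial V c"
  using not_colorable by (auto simp: partial_def)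

text \<open>
A deleted vertex sees at most one coloured vertex, so the multiplicities around it are trivially odd.
\<close>
lemma partial_after_deletion:
  assumes "U \<subseteq> V" "U \<noteq> {}" "\<forall>u\<in>U. \<exists>z. N u \<subseteq> insert z U"
  shows "\<exists>c. partial (V - U) c"
proof -
  obtain c where c: "partial_coloring adj (D + 4) (V - U) (V - U) c"
    using smaller_colorable[OF assms(1,2)] by blast
  have "odd_on c {u\<in>V-U. adj v u}" if v: "v \<in> U" for v
  proof -
    obtain z where "N v \<subseteq> insert z U" using assms(3) v by blast
    then have "{u\<in>V-U. adj v u} \<subseteq> {z}" by (auto simp: N_def)
    then show ?thesis by (intro odd_on_inj) (auto simp: inj_on_def)
  qed
  then have "partial (V - U) c" using c assms(1) by (auto simp: partial_def partial_coloring_def)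
  then show ?thesis by blast
qed

text \<open>
The vertices whose colours must be avoided at \<open>u\<close> if multiplicities around the vertices in \<open>Z\<close> are
accounted for separately; \<open>near {} u\<close> consists of all other vertices within distance two.
\<close>
definition near :: "'a set \<Rightarrow> 'a \<Rightarrow> 'a set" where
  "near Z u = (N u \<union> \<Union> (N ` (N u - Z))) - {u}"

definition avail :: "'a set \<Rightarrow> 'a set \<Rightarrow> ('a \<Rightarrow> nat) \<Rightarrow> 'a \<Rightarrow> nat set" where
  "avail Z S c u = {1..D+4} - c ` (near Z u \<inter> S)"

lemma near_V: "near Z u \<subseteq> V" using N_sub by (auto simp: near_def)

lemma finite_near [simp]: "finite (near Z u)" using near_V fin finite_subset by blast

lemma finite_avail [simp]: "finite (avail Z S c u)" by (simp add: avail_def)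

lemma avail_mono: "avail {} S c u \<subseteq> avail Z S c u" by (auto simp: avail_def near_def)

lemma avail_neq: "\<alpha> \<in> avail Z S c u \<Longrightarrow> z \<in> near Z u \<inter> S \<Longrightarrow> \<alpha> \<noteq> c z"
  unfolding avail_def by blast

lemma card_avail: "D + 4 \<le> card (avail Z S c u) + card (near Z u \<inter> S)"
proof -
  have "card (c ` (near Z u \<inter> S)) \<le> card (near Z u \<inter> S)" by (rule card_image_le) simp
  moreover have "card {1..D+4} - card (c ` (near Z u \<inter> S)) \<le> card (avail Z S c u)"
    unfolding avail_def by (rule diff_card_le_card_Diff) simp
  ultimately show ?thesis by simp
qed

text \<open>
The common form of all extension steps.  Around a vertex outside \<open>Z\<close> every new colour occurs exactly
once; only around the vertices of \<open>Z\<close> may new vertices share a colour with each other or with old ones.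
\<close>
lemma extend_partial:
  assumes S: "partial S c" and W: "W \<subseteq> V - S"
    and av: "\<And>u. u \<in> W \<Longrightarrow> f u \<in> avail Z S c u"
    and conflict: "\<And>u u'. u \<in> W \<Longrightarrow> u' \<in> W \<Longrightarrow> u \<noteq> u' \<Longrightarrow>
      adj u u' \<or> (\<exists>w\<in>V - Z. w \<in> N u \<and> w \<in> N u') \<Longrightarrow> f u \<noteq> f u'"
    and special: "\<And>v. v \<in> Z \<Longrightarrow> v \<in> V \<Longrightarrow> odd_on (\<lambda>z. if z \<in> W then f z else c z) (N v \<inter> (S \<union> W))"
  shows "partial (S \<union> W) (\<lambda>z. if z \<in> W then f z else c z)"
proof -
  let ?c = "\<lambda>z. if z \<in> W then f z else c z"
  have SV: "S \<subseteq> V" and colS: "c ` S \<subseteq> {1..D+4}"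
    and propS: "\<And>u v. u \<in> S \<Longrightarrow> v \<in> S \<Longrightarrow> adj u v \<Longrightarrow> c u \<noteq> c v"
    and oddS: "\<And>v. v \<in> V \<Longrightarrow> odd_on c (N v \<inter> S)"
    using S by (auto simp: partial_iff)
  have far: "f u \<noteq> c z" if "u \<in> W" "z \<in> S" "z \<in> N u \<or> (\<exists>w \<in> N u - Z. z \<in> N w)" for u z
    using av[OF that(1)] that W by (fastforce simp: avail_def near_def)
  have cW: "?c ` (S \<union> W) \<subseteq> {1..D+4}" using colS av by (fastforce simp: avail_def)
  have "?c u \<noteq> ?c v" if uv: "u \<in> S \<union> W" "v \<in> S \<union> W" "adj u v" for u v
  proof -
    have ne: "u \<noteq> v" using uv adj_irrefl by auto
    have uV: "u \<in> V" "v \<in> V" "v \<in> N u" "u \<in> N v" using uv SV W adj_sym by (auto simp: N_def)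
    show ?thesis
      using conflict[of u v] far[of u v] far[of v u] propS[of u v] uv ne uV W by auto
  qed
  moreover have "odd_on ?c (N v \<inter> (S \<union> W))" if v: "v \<in> V" for v
  proof (cases "v \<in> Z")
    case True
    then show ?thesis using special v by blast
  next
    case False
    have 1: "odd_on ?c (N v \<inter> S)"
      using oddS[OF v] W by (subst odd_on_cong[where g = c]) auto
    have 2: "odd_on ?c (N v \<inter> W)"
    proof (rule odd_on_inj, rule inj_onI, rule ccontr)
      fix x y assume xy: "x \<in> N v \<inter> W" "y \<in> N v \<inter> W" "?c x = ?c y" "x \<noteq> y"
      have "v \<in> N x" "v \<in> N y" using xy N_sym v by auto
      then show False using conflict[of x y] xy False v by auto
    qed
    have "?c ` (N v \<inter> S) \<inter> ?c ` (N v \<inter> W) = {}"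
    proof -
      have "c z \<noteq> f u" if "z \<in> N v \<inter> S" "u \<in> N v \<inter> W" for z u
      proof -
        have "v \<in> N u" using that N_sym v by auto
        then have "z \<in> N u \<or> (\<exists>w\<in>N u - Z. z \<in> N w)" using that False by blast
        then show ?thesis using far[of u z] that by auto
      qed
      then have "c ` (N v \<inter> S) \<inter> f ` (N v \<inter> W) = {}" by blast
      moreover have "?c ` (N v \<inter> S) = c ` (N v \<inter> S)" using W by (intro image_cong) auto
      moreover have "?c ` (N v \<inter> W) = f ` (N v \<inter> W)" by (intro image_cong) auto
      ultimately show ?thesis by (simp only:)
    qed
    then have "odd_on ?c ((N v \<inter> S) \<union> (N v \<inter> W))" using odd_on_Un 1 2 by blast
    then show ?thesis by (simp add: Int_Un_distrib)
  qed
  moreover have "S \<union> W \<subseteq> V" using SV W by blast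
  ultimately show ?thesis using cW by (simp only: partial_iff) blast
qed

text \<open>
Counts the coloured vertices that constrain \<open>u\<close> through its neighbour \<open>w\<close>; the sum over \<open>N u\<close> bounds
the number of forbidden colours.
\<close>
definition cost :: "'a set \<Rightarrow> 'a \<Rightarrow> 'a \<Rightarrow> nat" where
  "cost S u w = card ((insert w (N w) - {u}) \<inter> S)"

lemma near_cost: "card (near {} u \<inter> S) \<le> (\<Sum>w\<in>N u. cost S u w)"
proof -
  have "near {} u \<inter> S = (\<Union>w\<in>N u. (insert w (N w) - {u}) \<inter> S)"
    by (auto simp: near_def)
  also have "card \<dots> \<le> (\<Sum>w\<in>N u. card ((insert w (N w) - {u}) \<inter> S))"
    by (rule card_UN_le) simp
  finally show ?thesis by (simp add: cost_def)
qed

lemma near_cost_except: "card (near {v} u \<inter> S) \<le> card ({v} \<inter> S) + (\<Sum>w\<in>N u - {v}. cost S u w)"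
proof -
  have "card (near {v} u \<inter> S) \<le> card (({v} \<inter> S) \<union> (\<Union>w\<in>N u - {v}. (insert w (N w) - {u}) \<inter> S))"
    by (intro card_mono) (auto simp: near_def)
  also have "\<dots> \<le> card ({v} \<inter> S) + card (\<Union>w\<in>N u - {v}. (insert w (N w) - {u}) \<inter> S)"
    by (rule card_Un_le)
  also have "card (\<Union>w\<in>N u - {v}. (insert w (N w) - {u}) \<inter> S) \<le> (\<Sum>w\<in>N u - {v}. card ((insert w (N w) - {u}) \<inter> S))"
    by (rule card_UN_le) simp
  finally show ?thesis by (simp add: cost_def)
qed

lemma cost_le_d:
  assumes "u \<in> V" "w \<in> N u"
  shows "cost S u w \<le> d w"
proof -
  have "u \<in> N w" using assms N_sym by blast
  then have "card (insert w (N w) - {u}) = d w"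
    by (simp add: d_def card_Diff_singleton)
  moreover have "cost S u w \<le> card (insert w (N w) - {u})"
    unfolding cost_def by (intro card_mono) auto
  ultimately show ?thesis by simp
qed

lemma cost_le_D: "u \<in> V \<Longrightarrow> w \<in> N u \<Longrightarrow> cost S u w \<le> D"
  using cost_le_d[of u w S] d_le[of w] N_sub by fastforce

lemma cost_le_list:
  assumes "(insert w (N w) - {u}) \<inter> S \<subseteq> set xs"
  shows "cost S u w \<le> length xs"
  unfolding cost_def using card_mono[OF _ assms] card_length[of xs] by simp

lemma extend_vertex:
  assumes "partial S c" "u \<in> V - S" "\<alpha> \<in> avail {} S c u"
  shows "partial (insert u S) (c(u := \<alpha>))"
proof -
  have "partial (S \<union> {u}) (\<lambda>z. if z \<in> {u} then \<alpha> else c z)"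
    by (rule extend_partial[where Z = "{}"]) (use assms in auto)
  moreover have "(\<lambda>z. if z \<in> {u} then \<alpha> else c z) = c(u := \<alpha>)" by auto
  ultimately show ?thesis by simp
qed

text \<open>
The case \<open>u \<in> S\<close> is included so that configurations in which two of the named vertices coincide need
no separate treatment.
\<close>
lemma greedy_near:
  assumes "\<exists>c. partial S c" "u \<in> V" "card (near {} u \<inter> S) \<le> D + 3"
  shows "\<exists>c. partial (insert u S) c"
proof (cases "u \<in> S")
  case True
  then show ?thesis using assms(1) by (simp add: insert_absorb)
next
  case False
  obtain c where c: "partial S c" using assms(1) by blast
  have "0 < card (avail {} S c u)"
    using card_avail[of "{}" S c u] assms(3) by linarith
  then obtain \<alpha> where "\<alpha> \<in> avail {} S c u" by (auto simp: card_gt_0_iff)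
  then show ?thesis using extend_vertex[OF c] assms(2) False by blast
qed

lemma greedy:
  assumes "\<exists>c. partial S c" "u \<in> V" "(\<Sum>w\<in>N u. cost S u w) \<le> D + 3"
  shows "\<exists>c. partial (insert u S) c"
  by (rule greedy_near[OF assms(1,2)]) (use near_cost[of u S] assms(3) in linarith)

text \<open>
The bound by the degree is strict while \<open>w\<close> has an uncoloured neighbour besides \<open>u\<close>.  This is the gain
whenever two vertices of a configuration share a neighbour by coincidence.
\<close>
lemma cost_less_d:
  assumes "u \<in> V" "w \<in> N u" "u' \<in> N w" "u' \<notin> S" "u' \<noteq> u"
  shows "cost S u w < d w"
proof -
  have "u \<in> N w" using assms N_sym by blast
  then have "card (insert w (N w) - {u}) = d w"
    by (simp add: d_def card_Diff_singleton)
  moreover have "card ((insert w (N w) - {u}) \<inter> S) < card (insert w (N w) - {u})"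
    using assms by (intro psubset_card_mono) auto
  ultimately show ?thesis by (simp add: cost_def)
qed

lemma cost_less_D: "u \<in> V \<Longrightarrow> w \<in> N u \<Longrightarrow> u' \<in> N w \<Longrightarrow> u' \<notin> S \<Longrightarrow> u' \<noteq> u \<Longrightarrow> cost S u w < D"
  using cost_less_d[of u w u' S] d_le[of w] N_sub by fastforce

lemma cost_le_1: "(insert w (N w) - {u}) \<inter> S \<subseteq> {x} \<Longrightarrow> cost S u w \<le> 1"
  using cost_le_list[of w u S "[x]"] by simp

lemma cost_le_2: "(insert w (N w) - {u}) \<inter> S \<subseteq> {x, y} \<Longrightarrow> cost S u w \<le> 2"
  using cost_le_list[of w u S "[x, y]"] by simp

lemma greedy_2:
  assumes "\<exists>c. partial S c" "u \<in> V" "N u = {x, y}" "cost S u x + cost S u y \<le> D + 3"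
  shows "\<exists>c. partial (insert u S) c"
proof (rule greedy[OF assms(1,2)])
  have "(\<Sum>w\<in>N u. cost S u w) \<le> cost S u x + cost S u y"
    unfolding assms(3) by (simp add: sum.insert_if)
  then show "(\<Sum>w\<in>N u. cost S u w) \<le> D + 3" using assms(4) by linarith
qed

lemma greedy_3:
  assumes "\<exists>c. partial S c" "u \<in> V" "N u = {x, y, z}" "cost S u x + cost S u y + cost S u z \<le> D + 3"
  shows "\<exists>c. partial (insert u S) c"
proof (rule greedy[OF assms(1,2)])
  have "(\<Sum>w\<in>N u. cost S u w) \<le> cost S u x + cost S u y + cost S u z"
    unfolding assms(3) by (simp add: sum.insert_if)
  then show "(\<Sum>w\<in>N u. cost S u w) \<le> D + 3" using assms(4) by linarith
qed

lemma greedy_4: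
  assumes "\<exists>c. partial S c" "u \<in> V" "N u = {x, y, z, w}" "cost S u x + cost S u y + cost S u z + cost S u w \<le> D + 3"
  shows "\<exists>c. partial (insert u S) c"
proof (rule greedy[OF assms(1,2)])
  have "(\<Sum>w\<in>N u. cost S u w) \<le> cost S u x + cost S u y + cost S u z + cost S u w"
    unfolding assms(3) by (simp add: sum.insert_if)
  then show "(\<Sum>w\<in>N u. cost S u w) \<le> D + 3" using assms(4) by linarith
qed

text \<open>
A 2-vertex next to a 3-vertex can always be coloured last: it sees at most \<open>3 + D\<close> colours.
\<close>
lemma greedy_beside_3:
  assumes "\<exists>c. partial S c" "u \<in> V" "N u = {v, x}" "d v \<le> 3"
  shows "\<exists>c. partial (insert u S) c"
proof (rule greedy_2[OF assms(1-3)])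
  have "cost S u v \<le> d v" "cost S u x \<le> D"
    using assms(3) by (auto intro: cost_le_d[OF assms(2)] cost_le_D[OF assms(2)])
  then show "cost S u v + cost S u x \<le> D + 3" using assms(4) by linarith
qed

text \<open>
With \<open>m\<close> coloured neighbours of \<open>v\<close> in distinct colours, two lists of \<open>m + 1\<close> colours suffice for the two
remaining neighbours \<open>x\<close> and \<open>y\<close>, although a rainbow choice may not exist.  If one of the \<open>m\<close> colours is in
both lists, then \<open>x\<close> and \<open>y\<close> both take it, which gives it multiplicity three.  Otherwise one of the lists
keeps two colours and the other keeps one after the \<open>m\<close> colours are removed.  If \<open>x\<close> and \<open>y\<close> have
another common neighbour, then repetition is impossible and one more colour is required.
\<close>
lemma extend_pair:
  assumes S: "partial S c" and v: "v \<in> V" and xy: "N v - S = {x, y}" "x \<noteq> y" "\<not> adj x y"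
    and m: "N v \<inter> S \<noteq> {}" "inj_on c (N v \<inter> S)"
    and x: "card (near {v} x \<inter> S) + card (N v \<inter> S) \<le> D + 3"
    and y: "card (near {v} y \<inter> S) + card (N v \<inter> S) \<le> D + 3"
    and common: "N x \<inter> N y \<noteq> {v} \<Longrightarrow> card (near {v} x \<inter> S) + card (N v \<inter> S) \<le> D + 2 \<and>
      card (near {v} y \<inter> S) + card (N v \<inter> S) \<le> D + 2"
  shows "\<exists>c. partial (S \<union> {x, y}) c"
proof -
  let ?X = "avail {v} S c x" and ?Y = "avail {v} S c y" and ?C = "c ` (N v \<inter> S)"
  have cC: "card ?C = card (N v \<inter> S)" using m(2) by (rule card_image)
  have finC: "finite ?C" by simp
  have xyN: "x \<in> N v" "y \<in> N v" "x \<notin> S" "y \<notin> S" using xy(1) by auto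
  have X: "card (N v \<inter> S) + 1 \<le> card ?X" using card_avail[of "{v}" S c x] x by linarith
  have Y: "card (N v \<inter> S) + 1 \<le> card ?Y" using card_avail[of "{v}" S c y] y by linarith
  have distinct: "\<exists>p\<in>A. \<exists>q\<in>B. p \<noteq> q" if "1 \<le> card A" "1 \<le> card B" "2 \<le> card A \<or> 2 \<le> card B" for A B :: "nat set"
  proof (rule ccontr)
    assume n: "\<not> ?thesis"
    have "A \<noteq> {}" "B \<noteq> {}" using that by auto
    then obtain a b where a: "a \<in> A" and b: "b \<in> B" by blast
    have "A \<subseteq> {b}" "B \<subseteq> {a}" using n a b by auto
    then have "card A \<le> card {b}" "card B \<le> card {a}" by (meson card_mono finite.emptyI finite_insert)+
    then show False using that(3) by simp
  qed
  have diff: "card A - card B \<le> card (A - B)" if "finite B" for A B :: "nat set"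
    using diff_card_le_card_Diff that by blast
  obtain p q where pq: "p \<in> ?X" "q \<in> ?Y"
    "(N x \<inter> N y = {v} \<and> p = q \<and> p \<in> ?C) \<or> (p \<noteq> q \<and> p \<notin> ?C \<and> q \<notin> ?C)"
  proof (cases "N x \<inter> N y = {v}")
    case False
    then have "card (N v \<inter> S) + 2 \<le> card ?X" "card (N v \<inter> S) + 2 \<le> card ?Y"
      using common card_avail[of "{v}" S c x] card_avail[of "{v}" S c y] by linarith+
    then have "2 \<le> card (?X - ?C)" "2 \<le> card (?Y - ?C)"
      using diff[OF finC, of ?X] diff[OF finC, of ?Y] cC by linarith+
    then show ?thesis using distinct[of "?X - ?C" "?Y - ?C"] that by fastforce
  next
    case True
    show ?thesis
    proof (cases "?X \<inter> ?Y \<inter> ?C = {}")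
      case False
      then show ?thesis using that True by blast
    next
      case empty: True
      obtain z where z: "z \<in> ?C" using m(1) by blast
      have drop: "2 \<le> card (A - ?C)" if "z \<notin> A" "card (N v \<inter> S) + 1 \<le> card A" for A
      proof -
        have "A - ?C = A - (?C - {z})" using that(1) by auto
        moreover have "card (?C - {z}) + 1 = card (N v \<inter> S)"
          using z finC cC by (metis card_Suc_Diff1 Suc_eq_plus1)
        ultimately show ?thesis using diff[of "?C - {z}" A] finC that(2) by simp
      qed
      have "1 \<le> card (?X - ?C)" "1 \<le> card (?Y - ?C)"
        using diff[OF finC, of ?X] diff[OF finC, of ?Y] cC X Y by linarith+
      moreover have "2 \<le> card (?X - ?C) \<or> 2 \<le> card (?Y - ?C)"
        using drop X Y empty z by blast
      ultimately show ?thesis using distinct[of "?X - ?C" "?Y - ?C"] that by blast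
    qed
  qed
  let ?f = "\<lambda>z. if z = x then p else q"
  let ?c = "\<lambda>z. if z \<in> {x,y} then ?f z else c z"
  have "partial (S \<union> {x,y}) ?c"
  proof (rule extend_partial[where Z = "{v}"])
    show "partial S c" by (rule S)
    show "{x,y} \<subseteq> V - S" using xyN N_sub by blast
    show "?f u \<in> avail {v} S c u" if "u \<in> {x,y}" for u using that pq xy(2) by auto
    fix u u' assume u: "u \<in> {x,y}" "u' \<in> {x,y}" "u \<noteq> u'"
      "adj u u' \<or> (\<exists>w\<in>V - {v}. w \<in> N u \<and> w \<in> N u')"
    then have "N x \<inter> N y \<noteq> {v}" using xy(3) adj_sym by blast
    then show "?f u \<noteq> ?f u'" using u pq(3) by auto
  next
    fix w assume "w \<in> {v}" "w \<in> V"
    then have "N w \<inter> (S \<union> {x,y}) = (N v \<inter> S) \<union> {x,y}" using xyN by auto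
    moreover have "odd_on ?c ((N v \<inter> S) \<union> {x,y})"
    proof (cases "p = q")
      case False
      then have "inj_on ?c ((N v \<inter> S) \<union> {x,y})"
        using pq(3) m(2) xyN xy(2) by (auto simp: inj_on_def)
      then show ?thesis by (rule odd_on_inj)
    next
      case True
      then obtain z where z: "z \<in> N v \<inter> S" "c z = p" using pq(3) by auto
      have ne: "x \<noteq> z" "y \<noteq> z" using z xyN by auto
      have "odd_on ?c {x,y,z}"
      proof (rule odd_on_const)
        show "?c u = p" if "u \<in> {x,y,z}" for u using that True z ne xyN by auto
        show "odd (card {x,y,z})" using ne xy(2) by simp
      qed
      moreover have "odd_on ?c ((N v \<inter> S) - {z})"
        by (intro odd_on_inj inj_onI) (use m(2) xyN in \<open>auto dest: inj_onD split: if_splits\<close>)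
      moreover have "?c ` {x,y,z} \<inter> ?c ` ((N v \<inter> S) - {z}) = {}"
      proof (rule disjoint_images)
        show "?c u = p" if "u \<in> {x,y,z}" for u using that True z ne xyN by auto
        show "?c u \<noteq> p" if "u \<in> (N v \<inter> S) - {z}" for u
          using that z inj_onD[OF m(2), of u z] xyN by auto
      qed
      ultimately have "odd_on ?c ({x,y,z} \<union> ((N v \<inter> S) - {z}))" by (rule odd_on_Un)
      moreover have "{x,y,z} \<union> ((N v \<inter> S) - {z}) = (N v \<inter> S) \<union> {x,y}" using z by auto
      ultimately show ?thesis by simp
    qed
    ultimately show "odd_on ?c (N w \<inter> (S \<union> {x,y}))" by simp
  qed
  then show ?thesis by blast
qed

section \<open>Stars around one vertex\<close>

text \<open>
Delete \<open>v\<close> together with the set \<open>W\<close> of 2-vertices around it.  First colour \<open>v\<close>, which sees one vertex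
beyond each member of \<open>W\<close> and at most \<open>D\<close> vertices through its remaining neighbour.  The vertices of \<open>W\<close>
then have lists long enough for \<open>odd_choosable_large_lists\<close>, with the second neighbour as class: \<open>k\<close>
members of \<open>W\<close> with a common second neighbour are all uncoloured there, so that each of them has \<open>k - 1\<close>
more colours.
\<close>
lemma star_reducible:
  assumes v: "v \<in> V" and W: "W \<subseteq> N v"
    and W2: "\<And>w. w \<in> W \<Longrightarrow> d w = 2"
    and indep: "\<And>w w'. w \<in> W \<Longrightarrow> w' \<in> W \<Longrightarrow> \<not> adj w w'"
    and rest: "card (N v - W) \<le> 1" "card W div 2 + card (N v - W) \<le> 2"
  shows False
proof -
  let ?r = "card (N v - W)"
  have WV: "W \<subseteq> V" and finW: "finite W" and vW: "v \<notin> W"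
    using W N_sub N_irrefl finite_subset[OF W] by auto
  have "\<exists>x. N w = {v, x} \<and> x \<noteq> v" if w: "w \<in> W" for w
  proof -
    have "v \<in> N w" using N_sym[OF v] W w by auto
    then obtain y where "N w = {v, y}" "y \<noteq> v" by (rule nbrs_2[OF W2[OF w]])
    then show ?thesis by auto
  qed
  then obtain x where x: "\<And>w. w \<in> W \<Longrightarrow> N w = {v, x w}" "\<And>w. w \<in> W \<Longrightarrow> x w \<noteq> v" by metis
  have vN: "v \<in> N w" if "w \<in> W" for w using x that by blast
  have deg: "d v = card W + ?r"
    using W finW card_Diff_subset[OF finW W] card_mono[OF finite_N W] by (simp add: d_def)
  let ?S0 = "V - insert v W" and ?S1 = "V - W"
  have "\<exists>c. partial ?S0 c"
  proof (rule partial_after_deletion)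
    show "insert v W \<subseteq> V" using v WV by blast
    show "\<forall>u\<in>insert v W. \<exists>z. N u \<subseteq> insert z (insert v W)"
    proof
      fix u assume u: "u \<in> insert v W"
      show "\<exists>z. N u \<subseteq> insert z (insert v W)"
      proof (cases "u = v")
        case True
        have "\<exists>z. N v - W \<subseteq> {z}"
        proof (cases "N v - W = {}")
          case False
          then have "card (N v - W) = 1" using rest(1) by (simp add: card_gt_0_iff le_antisym Suc_leI)
          then show ?thesis by (auto simp: card_1_singleton_iff)
        qed auto
        then show ?thesis using True by blast
      next
        case False
        then have "N u \<subseteq> insert (x u) (insert v W)" using u x(1) by blast
        then show ?thesis by blast
      qed
    qed
  qed simp
  then have "\<exists>c. partial (insert v ?S0) c"
  proof (rule greedy[OF _ v])
    have 1: "cost ?S0 v w \<le> 1" if "w \<in> W" for w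
      by (rule cost_le_1[where x = "x w"]) (use x that in auto)
    have "(\<Sum>w\<in>N v. cost ?S0 v w) = (\<Sum>w\<in>W. cost ?S0 v w) + (\<Sum>w\<in>N v - W. cost ?S0 v w)"
      using sum.subset_diff[OF W, of "cost ?S0 v"] by simp
    also have "\<dots> \<le> card W * 1 + ?r * D"
      using sum_bounded_above[of W "cost ?S0 v" 1] sum_bounded_above[of "N v - W" "cost ?S0 v" D]
        1 cost_le_D[OF v] by (intro add_mono) auto
    also have "\<dots> \<le> D + 3"
    proof (cases "?r = 0")
      case True
      then show ?thesis using deg d_le[OF v] by (simp only: True)
    next
      case False
      then have "?r = 1" using rest(1) by linarith
      then show ?thesis using rest(2) by simp
    qed
    finally show "(\<Sum>w\<in>N v. cost ?S0 v w) \<le> D + 3" .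
  qed
  moreover have "insert v ?S0 = ?S1" using v vW by auto
  ultimately obtain c where c: "partial ?S1 c" by auto
  have avail_large: "card W div 2 + card {w'\<in>W. x w' = x w} \<le> card (avail {} ?S1 c w)" if w: "w \<in> W" for w
  proof -
    let ?G = "{w'\<in>W. x w' = x w}" and ?B = "insert (x w) (N (x w))"
    have xV: "x w \<in> V" using x(1)[OF w] N_sub by blast
    have G: "?G \<subseteq> N (x w)"
    proof
      fix w' assume "w' \<in> ?G"
      then have "x w \<in> N w'" "w' \<in> V" using x(1) WV by auto
      then show "w' \<in> N (x w)" by (rule N_sym[rotated])
    qed
    have finG: "finite ?G" using finW by simp
    have "near {} w \<inter> ?S1 \<subseteq> ({v} \<union> (N v - W)) \<union> (?B - ?G)"
      using x(1)[OF w] by (auto simp: near_def)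
    then have "card (near {} w \<inter> ?S1) \<le> card (({v} \<union> (N v - W)) \<union> (?B - ?G))"
      by (intro card_mono) auto
    also have "\<dots> \<le> card ({v} \<union> (N v - W)) + card (?B - ?G)" by (rule card_Un_le)
    also have "card ({v} \<union> (N v - W)) \<le> 1 + ?r"
      using card_Un_le[of "{v}" "N v - W"] by simp
    also have "card (?B - ?G) = Suc (d (x w)) - card ?G"
      using G finG by (subst card_Diff_subset) (auto simp: d_def)
    finally have "card (near {} w \<inter> ?S1) \<le> 1 + ?r + (Suc (d (x w)) - card ?G)" by simp
    moreover have "card ?G \<le> d (x w)" unfolding d_def by (rule card_mono[OF finite_N G])
    ultimately show ?thesis
      using card_avail[of "{}" ?S1 c w] d_le[OF xV] rest(2) by linarith
  qed
  have "odd_choosable x (avail {} ?S1 c) W"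
    by (rule odd_choosable_large_lists) (use finW avail_large in auto)
  then obtain f where f: "\<And>w. w \<in> W \<Longrightarrow> f w \<in> avail {} ?S1 c w"
    "\<And>w w'. w \<in> W \<Longrightarrow> w' \<in> W \<Longrightarrow> w \<noteq> w' \<Longrightarrow> x w = x w' \<Longrightarrow> f w \<noteq> f w'" "odd_on f W"
    unfolding odd_choosable_def by blast
  let ?c = "\<lambda>z. if z \<in> W then f z else c z"
  have "partial (?S1 \<union> W) ?c"
  proof (rule extend_partial[OF c, where Z = "{v}"])
    show "W \<subseteq> V - ?S1" using WV by blast
    show "f w \<in> avail {v} ?S1 c w" if "w \<in> W" for w using f(1)[OF that] avail_mono by blast
    fix w w' assume ww: "w \<in> W" "w' \<in> W" "w \<noteq> w'" "adj w w' \<or> (\<exists>z\<in>V - {v}. z \<in> N w \<and> z \<in> N w')"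
    then obtain z where "z \<noteq> v" "z \<in> N w" "z \<in> N w'" using indep by blast
    then have "x w = x w'" using x(1) ww by auto
    then show "f w \<noteq> f w'" using f(2) ww by blast
  next
    fix v' assume "v' \<in> {v}" "v' \<in> V"
    then have "N v' \<inter> (?S1 \<union> W) = (N v \<inter> ?S1) \<union> W" using W N_sub WV by blast
    moreover have "odd_on ?c ((N v \<inter> ?S1) \<union> W)"
    proof (rule odd_on_Un)
      have "odd_on c (N v \<inter> ?S1)" using c v by (simp add: partial_iff)
      then show "odd_on ?c (N v \<inter> ?S1)" by (subst odd_on_cong[where g = c]) auto
      show "odd_on ?c W" using f(3) by (subst odd_on_cong[where g = f]) auto
      have "c z \<noteq> f w" if "z \<in> N v \<inter> ?S1" "w \<in> W" for z w
      proof -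
        have "z \<in> near {} w \<inter> ?S1" using that x(1)[OF that(2)] by (auto simp: near_def)
        then show ?thesis using avail_neq[OF f(1)[OF that(2)]] by metis
      qed
      then have "c ` (N v \<inter> ?S1) \<inter> f ` W = {}" by blast
      moreover have "?c ` (N v \<inter> ?S1) = c ` (N v \<inter> ?S1)" by (intro image_cong) auto
      moreover have "?c ` W = f ` W" by (intro image_cong) auto
      ultimately show "?c ` (N v \<inter> ?S1) \<inter> ?c ` W = {}" by (simp only:)
    qed
    ultimately show "odd_on ?c (N v' \<inter> (?S1 \<union> W))" by simp
  qed
  moreover have "?S1 \<union> W = V" using WV by blast
  ultimately show False using not_partial_V by simp
qed

text \<open>
The degenerate star without leaves.
\<close>
lemma min_degree: "v \<in> V \<Longrightarrow> 2 \<le> d v"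
  using star_reducible[of v "{}"] by (force simp: d_def)

lemma not_adj_2_2:
  assumes "u \<in> V" "v \<in> V" "d u = 2" "d v = 2"
  shows "\<not> adj u v"
proof
  assume "adj u v"
  then have v: "v \<in> N u" using assms(2) by (simp add: N_def)
  have "card (N u - {v}) = 1" using assms(3) v by (simp add: d_def card_Diff_singleton)
  then show False using star_reducible[of u "{v}"] assms v adj_irrefl by auto
qed

definition two_nbrs :: "'a \<Rightarrow> 'a set" where "two_nbrs v = {w\<in>N v. d w = 2}"

definition bad :: "'a \<Rightarrow> bool" where "bad v \<longleftrightarrow> v \<in> V \<and> d v = 3 \<and> two_nbrs v \<noteq> {}"

lemma star_two_nbrs:
  assumes "v \<in> V" "k \<le> card (two_nbrs v)" "d v - k \<le> 1" "k div 2 + (d v - k) \<le> 2"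
  shows False
proof -
  obtain W where W: "W \<subseteq> two_nbrs v" "card W = k" "finite W"
    using obtain_subset_with_card_n[OF assms(2)] by metis
  have WN: "W \<subseteq> N v" using W(1) by (auto simp: two_nbrs_def)
  then have r: "card (N v - W) = d v - k" using W by (simp add: card_Diff_subset d_def)
  show False
  proof (rule star_reducible[OF assms(1) WN])
    show "d w = 2" if "w \<in> W" for w using that W(1) by (auto simp: two_nbrs_def)
    show "\<not> adj w w'" if "w \<in> W" "w' \<in> W" for w w'
      by (rule not_adj_2_2) (use that W(1) N_sub in \<open>auto simp: two_nbrs_def\<close>)
  qed (use r assms W in auto)
qed

lemma two_nbrs_3: "v \<in> V \<Longrightarrow> d v = 3 \<Longrightarrow> card (two_nbrs v) \<le> 1"
  using star_two_nbrs[of v 2] by force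

lemma two_nbrs_4: "v \<in> V \<Longrightarrow> d v = 4 \<Longrightarrow> card (two_nbrs v) \<le> 2"
  using star_two_nbrs[of v 3] by force

lemma two_nbrs_5: "v \<in> V \<Longrightarrow> d v = 5 \<Longrightarrow> card (two_nbrs v) \<le> 4"
  using star_two_nbrs[of v 5] by force

lemma badE:
  assumes "bad v" "a \<in> N v" "d a \<noteq> 2"
  obtains u b x where "N v = {a, u, b}" "u \<noteq> a" "b \<noteq> a" "u \<noteq> b" "d u = 2" "d b \<noteq> 2" "N u = {v, x}" "x \<noteq> v"
    "u \<in> V" "b \<in> V" "x \<in> V"
proof -
  obtain u where u: "u \<in> N v" "d u = 2" using assms(1) by (auto simp: bad_def two_nbrs_def)
  have "u \<noteq> a" using u assms(3) by auto
  have V: "v \<in> V" "d v = 3" using assms(1) by (auto simp: bad_def)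
  obtain y z where yz: "N v = {a, y, z}" "y \<noteq> a" "z \<noteq> a" "y \<noteq> z" using nbrs_3[OF V(2) assms(2)] by blast
  obtain b where b: "N v = {a, u, b}" "b \<noteq> a" "u \<noteq> b" using u \<open>u \<noteq> a\<close> yz by auto
  have "d b \<noteq> 2"
  proof
    assume "d b = 2"
    then have "{u, b} \<subseteq> two_nbrs v" using b u by (auto simp: two_nbrs_def)
    moreover have "finite (two_nbrs v)" by (simp add: two_nbrs_def)
    ultimately have "card {u, b} \<le> card (two_nbrs v)" by (intro card_mono)
    then show False using two_nbrs_3[OF V] b(3) by simp
  qed
  moreover obtain x where "N u = {v, x}" "x \<noteq> v" using nbrs_2[OF u(2)] N_sym[OF V(1) u(1)] by blast
  ultimately show ?thesis using that[of u b x] b u \<open>u \<noteq> a\<close> N_sub by blast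
qed

text \<open>
Two adjacent bad vertices and their 2-neighbours are deleted and coloured greedily, the 2-vertices
last.
\<close>
lemma not_adj_bad_bad:
  assumes "bad v" "bad a"
  shows "a \<notin> N v"
proof
  assume av: "a \<in> N v"
  have V: "v \<in> V" "a \<in> V" "d v = 3" "d a = 3" using assms by (auto simp: bad_def)
  have va: "v \<in> N a" using av V N_sym by blast
  have d2: "d a \<noteq> 2" "d v \<noteq> 2" using V by auto
  obtain u b x where 1: "N v = {a, u, b}" "u \<noteq> a" "b \<noteq> a" "u \<noteq> b" "d u = 2" "d b \<noteq> 2" "N u = {v, x}" "x \<noteq> v"
    "u \<in> V" "b \<in> V" "x \<in> V"
    by (rule badE[OF assms(1) av d2(1)])
  obtain u' b' x' where 2: "N a = {v, u', b'}" "u' \<noteq> v" "b' \<noteq> v" "u' \<noteq> b'" "d u' = 2" "d b' \<noteq> 2" "N u' = {a, x'}" "x' \<noteq> a"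
    "u' \<in> V" "b' \<in> V" "x' \<in> V"
    by (rule badE[OF assms(2) va d2(2)])
  have ne: "v \<noteq> a" "u \<noteq> v" "u \<noteq> a" "u' \<noteq> v" "u' \<noteq> a" using av 1(5) 2(5) V by auto
  note ne = ne ne[symmetric]
  let ?S = "V - {v, a, u, u'}"
  have "\<exists>c. partial ?S c"
  proof (rule partial_after_deletion)
    show "{v, a, u, u'} \<subseteq> V" using V 1(9) 2(9) by auto
    have "N v \<subseteq> insert b {v, a, u, u'}" "N a \<subseteq> insert b' {v, a, u, u'}"
      "N u \<subseteq> insert x {v, a, u, u'}" "N u' \<subseteq> insert x' {v, a, u, u'}"
      unfolding 1(1,7) 2(1,7) by auto
    then show "\<forall>z\<in>{v, a, u, u'}. \<exists>y. N z \<subseteq> insert y {v, a, u, u'}" by blast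
  qed simp
  then have "\<exists>c. partial (insert v ?S) c"
  proof (rule greedy_3[OF _ V(1) 1(1)])
    have "cost ?S v a \<le> 1" by (rule cost_le_1[of _ _ _ b']) (auto simp: 2(1,7) ne)
    moreover have "cost ?S v u \<le> 1" by (rule cost_le_1[of _ _ _ x]) (auto simp: 1(1,7) ne)
    moreover have "cost ?S v b \<le> D" by (rule cost_le_D) (simp_all add: V 1)
    ultimately show "cost ?S v a + cost ?S v u + cost ?S v b \<le> D + 3" by linarith
  qed
  then have "\<exists>c. partial (insert a (insert v ?S)) c" (is "\<exists>c. partial (insert a ?S1) c")
  proof (rule greedy_3[OF _ V(2) 2(1)])
    have "cost ?S1 a v \<le> 2" by (rule cost_le_2[of _ _ _ v b]) (auto simp: 1(1,7) ne)
    moreover have "cost ?S1 a u' \<le> 1" by (rule cost_le_1[of _ _ _ x']) (auto simp: 2(1,7) ne)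
    moreover have "cost ?S1 a b' \<le> D" by (rule cost_le_D) (simp_all add: V 2)
    ultimately show "cost ?S1 a v + cost ?S1 a u' + cost ?S1 a b' \<le> D + 3" by linarith
  qed
  then have "\<exists>c. partial (insert u (insert a ?S1)) c"
    by (rule greedy_beside_3[OF _ 1(9,7)]) (simp add: V)
  then have "\<exists>c. partial (insert u' (insert u (insert a ?S1))) c"
    by (rule greedy_beside_3[OF _ 2(9,7)]) (simp add: V)
  moreover have "insert u' (insert u (insert a ?S1)) = V" using V 1(9) 2(9) by auto
  ultimately show False using not_partial_V by simp
qed

section \<open>Two bad vertices close to each other\<close>

text \<open>
Here and in the next lemma the second part concerns a further common neighbour with an uncoloured
vertex: it lowers the count by one, as \<open>extend_pair\<close> demands.
\<close>
lemma card_near_2_vertex: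
  assumes "u \<in> V" "N u = {v, x}" "x \<noteq> v" "v \<in> S"
  shows "card (near {v} u \<inter> S) \<le> D + 1"
    and "z \<in> N u \<Longrightarrow> z \<in> N u' \<Longrightarrow> z \<noteq> v \<Longrightarrow> u' \<in> V \<Longrightarrow> u' \<notin> S \<Longrightarrow> u' \<noteq> u \<Longrightarrow>
      card (near {v} u \<inter> S) \<le> D"
proof -
  have "N u - {v} = {x}" using assms by auto
  then have le: "card (near {v} u \<inter> S) \<le> 1 + cost S u x"
    using near_cost_except[of v u S] assms(4) by simp
  have xN: "x \<in> N u" using assms by simp
  show "card (near {v} u \<inter> S) \<le> D + 1" using le cost_le_D[OF assms(1) xN, of S] by linarith
  assume z: "z \<in> N u" "z \<in> N u'" "z \<noteq> v" "u' \<in> V" "u' \<notin> S" "u' \<noteq> u"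
  then have "u' \<in> N x" using N_sym[of u' z] assms(2) by auto
  then have "cost S u x < D" using cost_less_D[OF assms(1) xN] z by blast
  then show "card (near {v} u \<inter> S) \<le> D" using le by linarith
qed

lemma card_near_bad:
  assumes "v \<in> V" "N v = {a, u, b}" "u \<noteq> a" "b \<noteq> a" "u \<noteq> b" "N u = {v, x}" "u \<notin> S" "a \<in> S"
  shows "card (near {a} v \<inter> S) \<le> D + 2"
    and "z \<in> N v \<Longrightarrow> z \<in> N v' \<Longrightarrow> z \<noteq> a \<Longrightarrow> v' \<in> V \<Longrightarrow> v' \<notin> S \<Longrightarrow> v' \<noteq> v \<Longrightarrow>
      card (near {a} v \<inter> S) \<le> D + 1"
proof -
  have "N v - {a} = {u, b}" using assms by auto
  then have le: "card (near {a} v \<inter> S) \<le> 1 + cost S v u + cost S v b"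
    using near_cost_except[of a v S] assms(5,8) by simp
  have bN: "b \<in> N v" using assms by simp
  have cu: "cost S v u \<le> 1" by (rule cost_le_1[of _ _ _ x]) (use assms(6,7) in auto)
  have cb: "cost S v b \<le> D" by (rule cost_le_D[OF assms(1) bN])
  show "card (near {a} v \<inter> S) \<le> D + 2" using le cu cb by linarith
  assume z: "z \<in> N v" "z \<in> N v'" "z \<noteq> a" "v' \<in> V" "v' \<notin> S" "v' \<noteq> v"
  then have v': "v' \<in> N z" using N_sym by blast
  have "z = u \<or> z = b" using z assms(2) by auto
  then show "card (near {a} v \<inter> S) \<le> D + 1"
  proof
    assume "z = u"
    then have "x = v'" using v' assms(6) z(6) by auto
    then have "(insert u (N u) - {v}) \<inter> S = {}" using assms(6,7) z(5) by auto
    then show ?thesis using le cb by (simp add: cost_def)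
  next
    assume "z = b"
    then have "cost S v b < D" using cost_less_D[OF assms(1) bN] v' z by blast
    then show ?thesis using le cu by linarith
  qed
qed

text \<open>
For two bad neighbours \<open>v\<close>, \<open>v'\<close> of a 3-vertex \<open>a\<close> with third neighbour \<open>w\<close>, colour \<open>a\<close> first and then
\<open>v\<close> and \<open>v'\<close> together by \<open>extend_pair\<close>, so that both may repeat the colour of \<open>w\<close>.
\<close>
lemma bad_nbr_unique:
  assumes "a \<in> V" "d a = 3" "v \<in> N a" "v' \<in> N a" "bad v" "bad v'"
  shows "v = v'"
proof (rule ccontr)
  assume vv: "v \<noteq> v'"
  have V: "v \<in> V" "v' \<in> V" "d v = 3" "d v' = 3" "d a \<noteq> 2" using assms by (auto simp: bad_def)
  have "\<not> bad a" using not_adj_bad_bad[of a v] assms by blast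
  then have no2: "two_nbrs a = {}" using assms by (simp add: bad_def)
  obtain y z where yz: "N a = {v, y, z}" "y \<noteq> v" "z \<noteq> v" "y \<noteq> z" by (rule nbrs_3[OF assms(2,3)])
  define w where "w = (if v' = y then z else y)"
  have w: "N a = {v, v', w}" "w \<noteq> v" "w \<noteq> v'" using yz assms(4) vv by (auto simp: w_def)
  have "w \<in> N a" using w by simp
  then have dw: "d w \<noteq> 2" "w \<in> V" "w \<noteq> a" using no2 N_sub by (auto simp: two_nbrs_def)
  have av: "a \<in> N v" "a \<in> N v'" using assms N_sym by blast+
  obtain u b x where 1: "N v = {a, u, b}" "u \<noteq> a" "b \<noteq> a" "u \<noteq> b" "d u = 2" "d b \<noteq> 2" "N u = {v, x}" "x \<noteq> v"
    "u \<in> V" "b \<in> V" "x \<in> V"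
    by (rule badE[OF assms(5) av(1) V(5)])
  obtain u' b' x' where 2: "N v' = {a, u', b'}" "u' \<noteq> a" "b' \<noteq> a" "u' \<noteq> b'" "d u' = 2" "d b' \<noteq> 2" "N u' = {v', x'}" "x' \<noteq> v'"
    "u' \<in> V" "b' \<in> V" "x' \<in> V"
    by (rule badE[OF assms(6) av(2) V(5)])
  have ne: "v \<noteq> a" "v' \<noteq> a" "u \<noteq> a" "u' \<noteq> a" "u \<noteq> v" "u' \<noteq> v" "u \<noteq> v'" "u' \<noteq> v'" "v \<noteq> v'" "w \<noteq> u" "w \<noteq> u'"
    using av 1(5) 2(5) V vv dw by auto
  note ne = ne ne[symmetric]
  let ?U = "{a, v, v', u, u'}"
  let ?S = "V - ?U" let ?S1 = "insert a ?S"
  have "\<exists>c. partial ?S c"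
  proof (rule partial_after_deletion)
    show "?U \<subseteq> V" using assms(1) V 1(9) 2(9) by auto
    have "N a \<subseteq> insert w ?U" "N v \<subseteq> insert b ?U" "N v' \<subseteq> insert b' ?U"
      "N u \<subseteq> insert x ?U" "N u' \<subseteq> insert x' ?U"
      unfolding 1(1,7) 2(1,7) w(1) by auto
    then show "\<forall>z\<in>?U. \<exists>y. N z \<subseteq> insert y ?U" by blast
  qed simp
  then have "\<exists>c. partial ?S1 c"
  proof (rule greedy_3[OF _ assms(1) w(1)])
    have "cost ?S a v \<le> 1" by (rule cost_le_1[of _ _ _ b]) (auto simp: 1(1,7) ne)
    moreover have "cost ?S a v' \<le> 1" by (rule cost_le_1[of _ _ _ b']) (auto simp: 2(1,7) ne)
    moreover have "cost ?S a w \<le> D" by (rule cost_le_D) (simp_all add: assms w)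
    ultimately show "cost ?S a v + cost ?S a v' + cost ?S a w \<le> D + 3" by linarith
  qed
  then obtain c where c: "partial ?S1 c" by blast
  have Na: "N a - ?S1 = {v, v'}" "N a \<inter> ?S1 = {w}"
    unfolding w(1) using ne dw V w by auto
  have S1: "u \<notin> ?S1" "u' \<notin> ?S1" "v \<notin> ?S1" "v' \<notin> ?S1" "a \<in> ?S1" using ne by auto
  note near = card_near_bad[OF V(1) 1(1-4) 1(7) S1(1,5)] and near' = card_near_bad[OF V(2) 2(1-4) 2(7) S1(2,5)]
  have "\<exists>c. partial (?S1 \<union> {v, v'}) c"
  proof (rule extend_pair[OF c assms(1) Na(1) vv])
    show "\<not> adj v v'" using not_adj_bad_bad[OF assms(5,6)] V(2) by (simp add: N_def)
    show "N a \<inter> ?S1 \<noteq> {}" "inj_on c (N a \<inter> ?S1)" using Na(2) by simp_all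
    show "card (near {a} v \<inter> ?S1) + card (N a \<inter> ?S1) \<le> D + 3"
      "card (near {a} v' \<inter> ?S1) + card (N a \<inter> ?S1) \<le> D + 3"
      unfolding Na(2) using near(1) near'(1) by simp_all
    assume "N v \<inter> N v' \<noteq> {a}"
    then obtain z where z: "z \<in> N v" "z \<in> N v'" "z \<noteq> a" using av by blast
    show "card (near {a} v \<inter> ?S1) + card (N a \<inter> ?S1) \<le> D + 2 \<and>
      card (near {a} v' \<inter> ?S1) + card (N a \<inter> ?S1) \<le> D + 2"
      unfolding Na(2) using near(2)[OF z V(2) S1(4) vv[symmetric]] near'(2)[OF z(2,1,3) V(1) S1(3) vv] by simp
  qed
  then have "\<exists>c. partial (insert u (?S1 \<union> {v, v'})) c"
    by (rule greedy_beside_3[OF _ 1(9,7)]) (simp add: V)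
  then have "\<exists>c. partial (insert u' (insert u (?S1 \<union> {v, v'}))) c"
    by (rule greedy_beside_3[OF _ 2(9,7)]) (simp add: V)
  moreover have "insert u' (insert u (?S1 \<union> {v, v'})) = V" using assms(1) V 1(9) 2(9) by auto
  ultimately show False using not_partial_V by simp
qed

text \<open>
The extremal 4-vertex of the discharging.  Its bad neighbours are coloured greedily before its
2-neighbours, for which \<open>extend_pair\<close> allows a repetition of the colour of a bad neighbour.
\<close>
lemma four_vertex_reducible:
  assumes v: "v \<in> V" "d v = 4" and Nv: "N v = {u, u', w, w'}" "distinct [u, u', w, w']"
    and du: "d u = 2" "d u' = 2" and b: "bad w" "bad w'"
  shows False
proof -
  have dw: "d w = 3" "d w' = 3" "d v \<noteq> 2" using v(2) b by (auto simp: bad_def)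
  have D4: "4 \<le> D" using d_le[OF v(1)] v(2) by simp
  have vin: "u \<in> N v" "u' \<in> N v" "w \<in> N v" "w' \<in> N v" using Nv by auto
  then have V: "u \<in> V" "u' \<in> V" "w \<in> V" "w' \<in> V" using N_sub by blast+
  have vN: "v \<in> N u" "v \<in> N u'" "v \<in> N w" "v \<in> N w'" using vin N_sym[OF v(1)] by blast+
  obtain x where x: "N u = {v, x}" "x \<noteq> v" by (rule nbrs_2[OF du(1) vN(1)])
  obtain x' where x': "N u' = {v, x'}" "x' \<noteq> v" by (rule nbrs_2[OF du(2) vN(2)])
  obtain y t z where 1: "N w = {v, y, t}" "y \<noteq> v" "t \<noteq> v" "y \<noteq> t" "d y = 2" "d t \<noteq> 2" "N y = {w, z}" "z \<noteq> w"
    "y \<in> V" "t \<in> V" "z \<in> V"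
    by (rule badE[OF b(1) vN(3) dw(3)])
  obtain y' t' z' where 2: "N w' = {v, y', t'}" "y' \<noteq> v" "t' \<noteq> v" "y' \<noteq> t'" "d y' = 2" "d t' \<noteq> 2" "N y' = {w', z'}" "z' \<noteq> w'"
    "y' \<in> V" "t' \<in> V" "z' \<in> V"
    by (rule badE[OF b(2) vN(4) dw(3)])
  have ne: "u \<noteq> u'" "u \<noteq> w" "u \<noteq> w'" "u' \<noteq> w" "u' \<noteq> w'" "w \<noteq> w'" "u \<noteq> v" "u' \<noteq> v" "w \<noteq> v" "w' \<noteq> v"
    "y \<noteq> v" "y' \<noteq> v" "y \<noteq> w" "y \<noteq> w'" "y' \<noteq> w" "y' \<noteq> w'"
    using Nv(2) dw du v(2) 1(5) 2(5) by auto
  note ne = ne ne[symmetric]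
  let ?U = "{v, w, w', u, u', y, y'}"
  let ?S = "V - ?U" let ?S1 = "insert v ?S" let ?S2 = "insert w ?S1" let ?S3 = "insert w' ?S2"
  have "\<exists>c. partial ?S c"
  proof (rule partial_after_deletion)
    show "?U \<subseteq> V" using v(1) V 1(9) 2(9) by auto
    have "N v \<subseteq> insert v ?U" "N w \<subseteq> insert t ?U" "N w' \<subseteq> insert t' ?U"
      "N u \<subseteq> insert x ?U" "N u' \<subseteq> insert x' ?U" "N y \<subseteq> insert z ?U" "N y' \<subseteq> insert z' ?U"
      unfolding 1(1,7) 2(1,7) Nv(1) x(1) x'(1) by auto
    then show "\<forall>z\<in>?U. \<exists>y. N z \<subseteq> insert y ?U" by blast
  qed simp
  then have "\<exists>c. partial ?S1 c"
  proof (rule greedy_4[OF _ v(1) Nv(1)])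
    have "cost ?S v u \<le> 1" by (rule cost_le_1[of _ _ _ x]) (auto simp: x(1) ne)
    moreover have "cost ?S v u' \<le> 1" by (rule cost_le_1[of _ _ _ x']) (auto simp: x'(1) ne)
    moreover have "cost ?S v w \<le> 1" by (rule cost_le_1[of _ _ _ t]) (auto simp: 1(1) ne)
    moreover have "cost ?S v w' \<le> 1" by (rule cost_le_1[of _ _ _ t']) (auto simp: 2(1) ne)
    ultimately show "cost ?S v u + cost ?S v u' + cost ?S v w + cost ?S v w' \<le> D + 3" using D4 by linarith
  qed
  then have "\<exists>c. partial ?S2 c"
  proof (rule greedy_3[OF _ V(3) 1(1)])
    have "cost ?S1 w v \<le> 1" by (rule cost_le_1[of _ _ _ v]) (auto simp: Nv(1) ne)
    moreover have "cost ?S1 w y \<le> 1" by (rule cost_le_1[of _ _ _ z]) (auto simp: 1(7) ne)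
    moreover have "cost ?S1 w t \<le> D" by (rule cost_le_D) (simp_all add: V 1)
    ultimately show "cost ?S1 w v + cost ?S1 w y + cost ?S1 w t \<le> D + 3" by linarith
  qed
  then have "\<exists>c. partial ?S3 c"
  proof (rule greedy_3[OF _ V(4) 2(1)])
    have "cost ?S2 w' v \<le> 2" by (rule cost_le_2[of _ _ _ v w]) (auto simp: Nv(1) ne)
    moreover have "cost ?S2 w' y' \<le> 1" by (rule cost_le_1[of _ _ _ z']) (auto simp: 2(7) ne)
    moreover have "cost ?S2 w' t' \<le> D" by (rule cost_le_D) (simp_all add: V 2)
    ultimately show "cost ?S2 w' v + cost ?S2 w' y' + cost ?S2 w' t' \<le> D + 3" by linarith
  qed
  then obtain c where c: "partial ?S3 c" by blast
  have Nv': "N v - ?S3 = {u, u'}" "N v \<inter> ?S3 = {w, w'}"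
    unfolding Nv(1) using ne by auto
  have S3: "u \<notin> ?S3" "u' \<notin> ?S3" "v \<in> ?S3" using ne by auto
  note near = card_near_2_vertex[OF V(1) x S3(3)] and near' = card_near_2_vertex[OF V(2) x' S3(3)]
  have two: "card (N v \<inter> ?S3) = 2" using Nv'(2) ne(6) by simp
  have "\<exists>c. partial (?S3 \<union> {u, u'}) c"
  proof (rule extend_pair[OF c v(1) Nv'(1) ne(1)])
    show "\<not> adj u u'" using not_adj_2_2 V du by blast
    show "N v \<inter> ?S3 \<noteq> {}" using Nv'(2) by simp
    have "odd_on c {w, w'}" using c v(1) Nv'(2) unfolding partial_iff by metis
    then have "c w \<noteq> c w'" using odd_on_pair ne(6) by metis
    then show "inj_on c (N v \<inter> ?S3)" unfolding Nv'(2) by (auto simp: inj_on_def)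
    show "card (near {v} u \<inter> ?S3) + card (N v \<inter> ?S3) \<le> D + 3"
      "card (near {v} u' \<inter> ?S3) + card (N v \<inter> ?S3) \<le> D + 3"
      unfolding two using near(1) near'(1) by simp_all
    assume "N u \<inter> N u' \<noteq> {v}"
    then obtain p where p: "p \<in> N u" "p \<in> N u'" "p \<noteq> v" using vN by blast
    show "card (near {v} u \<inter> ?S3) + card (N v \<inter> ?S3) \<le> D + 2 \<and>
      card (near {v} u' \<inter> ?S3) + card (N v \<inter> ?S3) \<le> D + 2"
      unfolding two using near(2)[OF p V(2) S3(2) ne(1)[symmetric]] near'(2)[OF p(2,1,3) V(1) S3(1) ne(1)] by simp
  qed
  then have "\<exists>c. partial (insert y (?S3 \<union> {u, u'})) c"
    by (rule greedy_beside_3[OF _ 1(9,7)]) (simp add: dw)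
  then have "\<exists>c. partial (insert y' (insert y (?S3 \<union> {u, u'}))) c"
    by (rule greedy_beside_3[OF _ 2(9,7)]) (simp add: dw)
  moreover have "insert y' (insert y (?S3 \<union> {u, u'})) = V" using v(1) V 1(9) 2(9) by auto
  ultimately show False using not_partial_V by simp
qed

section \<open>Paths of 3-vertices and small components\<close>

text \<open>
If exactly two colours are available at \<open>v\<close> and at most five coloured vertices are near \<open>v\<close>, then these
have five different colours.  So when the constraint from \<open>q\<close> is dropped, the colour of \<open>q\<close> becomes
available.  The second conclusion serves to
exclude coincidences among the vertices near \<open>v\<close>.
\<close>
lemma avail_after_drop:
  assumes c: "partial S c" and D: "3 \<le> D" and q: "q \<in> S"
    and near: "near {} v \<inter> S \<subseteq> insert q (near Z v \<inter> S)" "card (near Z v \<inter> S) \<le> 4"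
    and av: "card (avail {} S c v) = 2"
  shows "c q \<in> avail Z S c v" and "card (near Z v \<inter> S) = 4"
proof -
  have cS: "c ` S \<subseteq> {1..D+4}" using c by (simp add: partial_iff)
  have fin: "finite (near Z v \<inter> S)" by simp
  have "card (avail {} S c v) = D + 4 - card (c ` (near {} v \<inter> S))"
    unfolding avail_def using cS by (subst card_Diff_subset) auto
  then have five: "5 \<le> card (c ` (near {} v \<inter> S))" using av D by linarith
  have sub: "c ` (near {} v \<inter> S) \<subseteq> insert (c q) (c ` (near Z v \<inter> S))" using near(1) by blast
  have im: "card (c ` (near Z v \<inter> S)) \<le> card (near Z v \<inter> S)" by (rule card_image_le[OF fin])
  have "card (c ` (near {} v \<inter> S)) \<le> card (insert (c q) (c ` (near Z v \<inter> S)))"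
    using sub by (intro card_mono) auto
  also have "\<dots> \<le> Suc (card (c ` (near Z v \<inter> S)))" by (rule card_insert_le_m1) simp_all
  finally show "card (near Z v \<inter> S) = 4" using five im near(2) by linarith
  show "c q \<in> avail Z S c v"
  proof (rule ccontr)
    assume "c q \<notin> avail Z S c v"
    then have "c q \<in> c ` (near Z v \<inter> S)" using cS q by (auto simp: avail_def)
    then have "c ` (near {} v \<inter> S) \<subseteq> c ` (near Z v \<inter> S)" using sub by (simp only: insert_absorb)
    then have "card (c ` (near {} v \<inter> S)) \<le> card (c ` (near Z v \<inter> S))" by (intro card_mono) auto
    then show False using five im near(2) by linarith
  qed
qed

text \<open>
Three consecutive vertices \<open>v\<close>, \<open>a\<close>, \<open>p\<close> with the same list of two colours have no rainbow colouring.  But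
then the colour of the third neighbour \<open>q\<close> of \<open>a\<close> is available at \<open>v\<close> and at \<open>p\<close> as far as vertices other
than \<open>a\<close> are concerned, and using it for both makes the neighbourhood of \<open>a\<close> monochromatic.
\<close>
lemma path_equal_lists:
  assumes c: "partial S c" and D: "3 \<le> D" and deg: "\<And>z. z \<in> V \<Longrightarrow> d z \<le> 3"
    and V: "v \<in> V" "a \<in> V" "p \<in> V" "v' \<in> V" "b \<in> V" "r \<in> V"
    and out: "v \<notin> S" "a \<notin> S" "p \<notin> S" "v' \<notin> S" "u \<notin> S" "u' \<notin> S" "q \<in> S"
    and ne: "distinct [v, a, p, v', u]" "b \<noteq> a" "u \<noteq> b" "r \<noteq> a" "r \<noteq> v'" "r \<noteq> u" "b \<noteq> v'" "b \<noteq> p"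
    and Nv: "N v = {a, u, b}" and Na: "N a = {v, p, q}" and Np: "N p = {a, v', r}"
    and Nu: "N u = {v, x}" and Nv': "N v' = {p, u', b'}"
    and lists: "card (avail {} S c v) = 2" "avail {} S c a = avail {} S c v" "avail {} S c p = avail {} S c v"
      "2 \<le> card (avail {} S c v')"
  shows "\<exists>c. partial (S \<union> {v, a, p, v'}) c"
proof -
  have aS: "{a} \<inter> S = {}" using out by auto
  have nv: "near {} v \<inter> S \<subseteq> insert q (near {a} v \<inter> S)"
    using Na Nv out(1-3) by (auto simp: near_def)
  have np: "near {} p \<inter> S \<subseteq> insert q (near {a} p \<inter> S)"
    using Na Np out(1-3) by (auto simp: near_def)
  have "N v - {a} = {u, b}" using Nv ne by auto
  then have lv: "card (near {a} v \<inter> S) \<le> cost S v u + cost S v b"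
    using near_cost_except[of a v S] aS ne(3) by simp
  have "N p - {a} = {v', r}" using Np ne by auto
  then have lp: "card (near {a} p \<inter> S) \<le> cost S p v' + cost S p r"
    using near_cost_except[of a p S] aS ne(5) by simp
  have cu: "cost S v u \<le> 1" by (rule cost_le_1[of _ _ _ x]) (use Nu out in auto)
  have cv': "cost S p v' \<le> 1" by (rule cost_le_1[of _ _ _ b']) (use Nv' out in auto)
  have bN: "b \<in> N v" and rN: "r \<in> N p" using Nv Np by auto
  have cb: "cost S v b \<le> 3" using cost_le_d[OF V(1) bN, of S] deg[OF V(5)] by linarith
  have cr: "cost S p r \<le> 3" using cost_le_d[OF V(3) rN, of S] deg[OF V(6)] by linarith
  have v4: "card (near {a} v \<inter> S) \<le> 4" using lv cu cb by linarith
  have p4: "card (near {a} p \<inter> S) \<le> 4" using lp cv' cr by linarith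
  note av = avail_after_drop[OF c D out(7) nv v4 lists(1)]
  have "card (avail {} S c p) = 2" using lists by simp
  note ap = avail_after_drop[OF c D out(7) np p4 this]
  have "p \<notin> N b"
  proof
    assume "p \<in> N b"
    then have "cost S v b < d b" using cost_less_d[OF V(1) bN] out(3) ne(1) by auto
    then show False using av(2) lv cu deg[OF V(5)] by linarith
  qed
  then have "r \<noteq> b" using N_sym[OF V(3) rN] by auto
  then have common: "N v \<inter> N p \<subseteq> {a}" using Nv Np ne by auto
  have "p \<notin> N v" using Nv ne by auto
  then have nadj: "\<not> adj v p" using V(3) by (simp add: N_def)
  have "\<exists>\<omega>\<in>avail {} S c v'. \<omega> \<noteq> c q" using two_elems[OF lists(4)] by metis
  then obtain \<omega> where \<omega>: "\<omega> \<in> avail {} S c v'" "\<omega> \<noteq> c q" by blast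
  have "2 \<le> card (avail {} S c a)" using lists by simp
  then have "\<exists>\<alpha>\<in>avail {} S c a. \<alpha> \<noteq> \<omega>" using two_elems by metis
  then obtain \<alpha> where \<alpha>: "\<alpha> \<in> avail {} S c a" "\<alpha> \<noteq> \<omega>" by blast
  have "q \<in> near {} a \<inter> S" using Na out by (auto simp: near_def)
  then have \<alpha>q: "\<alpha> \<noteq> c q" by (rule avail_neq[OF \<alpha>(1)])
  let ?f = "\<lambda>z. if z = v \<or> z = p then c q else if z = a then \<alpha> else \<omega>"
  let ?W = "{v, a, p, v'}"
  let ?c = "\<lambda>z. if z \<in> ?W then ?f z else c z"
  have "partial (S \<union> ?W) ?c"
  proof (rule extend_partial[OF c, where Z = "{a}"])
    show "?W \<subseteq> V - S" using V out by auto
    show "?f z \<in> avail {a} S c z" if "z \<in> ?W" for z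
    proof -
      have "\<alpha> \<in> avail {a} S c a" "\<omega> \<in> avail {a} S c v'" using \<alpha> \<omega> avail_mono by blast+
      then show ?thesis using that av(1) ap(1) ne(1) by auto
    qed
    fix y y' assume y: "y \<in> ?W" "y' \<in> ?W" "y \<noteq> y'" "adj y y' \<or> (\<exists>w\<in>V - {a}. w \<in> N y \<and> w \<in> N y')"
    then have "{y, y'} \<noteq> {v, p}" using nadj common adj_sym by (auto simp: doubleton_eq_iff)
    then show "?f y \<noteq> ?f y'" using y(1-3) \<alpha>(2) \<omega>(2) \<alpha>q ne(1) by (auto simp: doubleton_eq_iff)
  next
    fix y assume "y \<in> {a}"
    then have "N y \<inter> (S \<union> ?W) = {v, p, q}" using Na out by auto
    moreover have "odd_on ?c {v, p, q}"
    proof (rule odd_on_const)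
      show "?c z = c q" if "z \<in> {v, p, q}" for z using that out by auto
      have "q \<noteq> v" "q \<noteq> p" using out by auto
      then show "odd (card {v, p, q})" using ne(1) by auto
    qed
    ultimately show "odd_on ?c (N y \<inter> (S \<union> ?W))" by simp
  qed
  then show ?thesis by blast
qed

text \<open>
The path \<open>u v a p v' u'\<close> joins the 2-vertices \<open>u\<close> and \<open>u'\<close>.  With all degrees at most 3 and at least seven
colours, each inner vertex has at least two available colours.  By \<open>square_path_lists\<close> either
the four inner vertices can be coloured so that only \<open>v\<close> and \<open>v'\<close> may agree, or \<open>path_equal_lists\<close>
applies to one of the two ends.
\<close>
lemma path_reducible:
  assumes deg: "\<And>z. z \<in> V \<Longrightarrow> d z \<le> 3"
    and b: "bad v" "bad v'" and a: "a \<in> N v" "d a = 3" "\<not> bad a"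
    and p: "p \<in> N v'" "d p = 3" "\<not> bad p" and ap: "p \<in> N a"
    and disj: "N v \<inter> N v' = {}"
  shows False
proof -
  have V: "v \<in> V" "v' \<in> V" "a \<in> V" "p \<in> V" using b a p N_sub by (auto simp: bad_def)
  have D: "3 \<le> D" using d_le[OF V(3)] a(2) by simp
  have d3: "d v = 3" "d v' = 3" using b by (auto simp: bad_def)
  have d2: "d a \<noteq> 2" "d p \<noteq> 2" using a p by auto
  have vN: "v \<in> N a" "v' \<in> N p" "a \<in> N p" using V a(1) p(1) ap N_sym by blast+
  obtain u e x where 1: "N v = {a, u, e}" "u \<noteq> a" "e \<noteq> a" "u \<noteq> e" "d u = 2" "d e \<noteq> 2" "N u = {v, x}" "x \<noteq> v"
    "u \<in> V" "e \<in> V" "x \<in> V"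
    by (rule badE[OF b(1) a(1) d2(1)])
  obtain u' e' x' where 2: "N v' = {p, u', e'}" "u' \<noteq> p" "e' \<noteq> p" "u' \<noteq> e'" "d u' = 2" "d e' \<noteq> 2" "N u' = {v', x'}" "x' \<noteq> v'"
    "u' \<in> V" "e' \<in> V" "x' \<in> V"
    by (rule badE[OF b(2) p(1) d2(2)])
  have vp: "v \<noteq> p" and v'a: "v' \<noteq> a" using b a p by auto
  obtain y z where yz: "N a = {v, y, z}" "y \<noteq> v" "z \<noteq> v" "y \<noteq> z" by (rule nbrs_3[OF a(2) vN(1)])
  define q where "q = (if p = y then z else y)"
  have q: "N a = {v, p, q}" "q \<noteq> v" "q \<noteq> p" using yz ap vp by (auto simp: q_def)
  obtain y' z' where yz': "N p = {v', y', z'}" "y' \<noteq> v'" "z' \<noteq> v'" "y' \<noteq> z'" by (rule nbrs_3[OF p(2) vN(2)])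
  define r where "r = (if a = y' then z' else y')"
  have r: "N p = {a, v', r}" "r \<noteq> v'" "r \<noteq> a" using yz' vN(3) v'a by (auto simp: r_def)
  have "q \<in> N a" "r \<in> N p" using q r by auto
  then have qr: "d q \<noteq> 2" "d r \<noteq> 2" "q \<in> V" "r \<in> V"
    using a p V N_sub by (auto simp: bad_def two_nbrs_def)
  have qa: "q \<noteq> a" "r \<noteq> p" using \<open>q \<in> N a\<close> \<open>r \<in> N p\<close> N_irrefl by blast+
  have nadj: "v' \<notin> N v" "v \<notin> N v'" using not_adj_bad_bad b by blast+
  have cross: "p \<notin> N v" "a \<notin> N v'" using disj a(1) p(1) by blast+
  have "v' \<notin> N a" using N_sym[OF V(3)] cross(2) by blast
  then have qv': "q \<noteq> v'" using \<open>q \<in> N a\<close> by auto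
  have "v \<notin> N p" using N_sym[OF V(4)] cross(1) by blast
  then have rv: "r \<noteq> v" using \<open>r \<in> N p\<close> by auto
  have "v \<noteq> v'" "a \<noteq> p" "v \<noteq> a" "v' \<noteq> p" using disj a(1) ap vN by auto
  moreover have "u \<notin> {v, v', a, p, q, r}" "u' \<notin> {v, v', a, p, q, r}"
    using 1(5) 2(5) d3 a(2) p(2) qr(1,2) by auto
  moreover have inN: "u \<in> N v" "u' \<in> N v'" "e \<in> N v" "e' \<in> N v'" using 1(1) 2(1) by simp_all
  moreover have "u \<noteq> u'" using inN(1,2) disj by blast
  moreover have "e \<noteq> p" "e \<noteq> v'" using inN(3) cross(1) nadj(1) by blast+
  moreover have "e' \<noteq> a" "e' \<noteq> v" using inN(4) cross(2) nadj(2) by blast+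
  ultimately have ne: "v \<noteq> v'" "a \<noteq> p" "v \<noteq> a" "v' \<noteq> p" "v \<noteq> p" "v' \<noteq> a" "u \<noteq> v" "u \<noteq> v'" "u \<noteq> a" "u \<noteq> p" "u' \<noteq> v" "u' \<noteq> v'"
    "u' \<noteq> a" "u' \<noteq> p" "u \<noteq> u'" "u \<noteq> q" "u' \<noteq> q" "u \<noteq> r" "u' \<noteq> r" "e \<noteq> p" "e' \<noteq> a" "e \<noteq> v'" "e' \<noteq> v"
    using vp v'a by simp_all
  note ne = ne ne[symmetric]
  let ?U = "{v, a, p, v', u, u'}"
  let ?S = "V - ?U" let ?W = "{v, a, p, v'}"
  have "\<exists>c. partial ?S c"
  proof (rule partial_after_deletion)
    show "?U \<subseteq> V" using V 1(9) 2(9) by auto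
    have "N a \<subseteq> insert q ?U" "N p \<subseteq> insert r ?U" "N v \<subseteq> insert e ?U" "N v' \<subseteq> insert e' ?U"
      "N u \<subseteq> insert x ?U" "N u' \<subseteq> insert x' ?U"
      unfolding 1(1,7) 2(1,7) q(1) r(1) by auto
    then show "\<forall>z\<in>?U. \<exists>y. N z \<subseteq> insert y ?U" by blast
  qed simp
  then obtain c where c: "partial ?S c" by blast
  have two: "2 \<le> card (avail {} ?S c w)" if "(\<Sum>z\<in>N w. cost ?S w z) \<le> 5" for w
    using card_avail[of "{}" ?S c w] near_cost[of w ?S] that D by linarith
  have cost3: "cost ?S w z \<le> 3" if "w \<in> V" "z \<in> N w" for w z
    using cost_le_d[OF that, of ?S] deg[of z] that(2) N_sub by fastforce
  have "cost ?S a v \<le> 1" by (rule cost_le_1[of _ _ _ e]) (auto simp: 1(1) ne)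
  moreover have "cost ?S a p \<le> 1" by (rule cost_le_1[of _ _ _ r]) (auto simp: r(1) ne)
  moreover have "cost ?S a q \<le> 3" by (rule cost3) (auto simp: q(1) V)
  ultimately have A: "2 \<le> card (avail {} ?S c a)" by (intro two) (use q ne in simp)
  have "cost ?S p v' \<le> 1" by (rule cost_le_1[of _ _ _ e']) (auto simp: 2(1) ne)
  moreover have "cost ?S p a \<le> 1" by (rule cost_le_1[of _ _ _ q]) (auto simp: q(1) ne)
  moreover have "cost ?S p r \<le> 3" by (rule cost3) (auto simp: r(1) V)
  ultimately have P: "2 \<le> card (avail {} ?S c p)" by (intro two) (use r ne in simp)
  have "cost ?S v a \<le> 1" by (rule cost_le_1[of _ _ _ q]) (auto simp: q(1) ne)
  moreover have "cost ?S v u \<le> 1" by (rule cost_le_1[of _ _ _ x]) (auto simp: 1(7) ne)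
  moreover have "cost ?S v e \<le> 3" by (rule cost3) (auto simp: 1(1) V)
  ultimately have L: "2 \<le> card (avail {} ?S c v)" by (intro two) (use 1 ne in simp)
  have "cost ?S v' p \<le> 1" by (rule cost_le_1[of _ _ _ r]) (auto simp: r(1) ne)
  moreover have "cost ?S v' u' \<le> 1" by (rule cost_le_1[of _ _ _ x']) (auto simp: 2(7) ne)
  moreover have "cost ?S v' e' \<le> 3" by (rule cost3) (auto simp: 2(1) V)
  ultimately have R: "2 \<le> card (avail {} ?S c v')" by (intro two) (use 2 ne in simp)
  have qS: "q \<in> ?S" "r \<in> ?S" using qr qa qv' rv q r ne by auto
  have outS: "v \<notin> ?S" "a \<notin> ?S" "p \<notin> ?S" "v' \<notin> ?S" "u \<notin> ?S" "u' \<notin> ?S" by auto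
  have "\<exists>c. partial (?S \<union> ?W) c"
    using square_path_lists[OF finite_avail finite_avail finite_avail finite_avail A P L R]
  proof (elim disjE bexE conjE)
    fix \<alpha> \<pi> \<beta> \<gamma>
    assume rainbow: "\<alpha> \<in> avail {} ?S c a" "\<pi> \<in> avail {} ?S c p" "\<beta> \<in> avail {} ?S c v" "\<gamma> \<in> avail {} ?S c v'"
      "\<alpha> \<noteq> \<pi>" "\<beta> \<notin> {\<alpha>, \<pi>}" "\<gamma> \<notin> {\<alpha>, \<pi>}"
    let ?f = "\<lambda>z. if z = v then \<beta> else if z = a then \<alpha> else if z = p then \<pi> else \<gamma>"
    have "partial (?S \<union> ?W) (\<lambda>z. if z \<in> ?W then ?f z else c z)"
    proof (rule extend_partial[OF c, where Z = "{}"])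
      show "?W \<subseteq> V - ?S" using V by auto
      show "?f z \<in> avail {} ?S c z" if "z \<in> ?W" for z using that rainbow(1-4) ne by auto
      fix y y' assume y: "y \<in> ?W" "y' \<in> ?W" "y \<noteq> y'" "adj y y' \<or> (\<exists>w\<in>V - {}. w \<in> N y \<and> w \<in> N y')"
      have "\<not> adj v v'" using nadj V by (simp add: N_def)
      then have "{y, y'} \<noteq> {v, v'}" using y(4) disj adj_sym by (auto simp: doubleton_eq_iff)
      then show "?f y \<noteq> ?f y'" using y(1-3) rainbow(5-7) ne by (auto simp: doubleton_eq_iff)
    qed simp
    then show "\<exists>c. partial (?S \<union> ?W) c" by blast
  next
    assume eq: "card (avail {} ?S c a) = 2" "avail {} ?S c p = avail {} ?S c a" "avail {} ?S c v = avail {} ?S c a"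
    have dist: "distinct [v, a, p, v', u]" using ne by simp
    have "r \<noteq> a" "r \<noteq> v'" "r \<noteq> u" "e \<noteq> p" "e \<noteq> v'" "e \<noteq> a" "u \<noteq> e" using ne r 1(3,4) by simp_all
    note path = path_equal_lists[OF c D deg V(1,3,4,2) 1(10) qr(4) outS qS(1) dist this(6,7,1,2,3,5,4)
        1(1) q(1) r(1) 1(7) 2(1)]
    show "\<exists>c. partial (?S \<union> ?W) c"
      by (rule path) (use eq R in simp_all)
  next
    assume eq: "card (avail {} ?S c a) = 2" "avail {} ?S c p = avail {} ?S c a" "avail {} ?S c v' = avail {} ?S c a"
    have Na': "N a = {p, v, q}" and Np': "N p = {v', a, r}" using q(1) r(1) by auto
    have dist: "distinct [v', p, a, v, u']" using ne by simp
    have "q \<noteq> p" "q \<noteq> v" "q \<noteq> u'" "e' \<noteq> a" "e' \<noteq> v" "e' \<noteq> p" "u' \<noteq> e'" using ne q 2(3,4) by simp_all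
    note path = path_equal_lists[OF c D deg V(2,4,3,1) 2(10) qr(3) outS(4,3,2,1,6,5) qS(2) dist this(6,7,1,2,3,5,4)
        2(1) Np' Na' 2(7) 1(1)]
    have "\<exists>c. partial (?S \<union> {v', p, a, v}) c"
      by (rule path) (use eq L in simp_all)
    moreover have "{v', p, a, v} = ?W" by auto
    ultimately show "\<exists>c. partial (?S \<union> ?W) c" by simp
  qed
  then have "\<exists>c. partial (insert u (?S \<union> ?W)) c"
    by (rule greedy_beside_3[OF _ 1(9,7)]) (simp add: d3)
  then have "\<exists>c. partial (insert u' (insert u (?S \<union> ?W))) c"
    by (rule greedy_beside_3[OF _ 2(9,7)]) (simp add: d3)
  moreover have "insert u' (insert u (?S \<union> ?W)) = V" using V 1(9) 2(9) by auto
  ultimately show False using not_partial_V by simp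
qed

text \<open>
Around a union of components with at most \<open>D + 4\<close> vertices every vertex can get a colour of its own.
\<close>
lemma small_component_reducible:
  assumes "U \<subseteq> V" "U \<noteq> {}" "card U \<le> D + 4" "\<And>u. u \<in> U \<Longrightarrow> N u \<subseteq> U"
  shows False
proof -
  have finU: "finite U" using assms(1) fin finite_subset by blast
  have "\<exists>c. partial ((V - U) \<union> A) c" if "A \<subseteq> U" "finite A" for A
    using that(2,1)
  proof (induction A)
    case empty
    then show ?case using partial_after_deletion[OF assms(1,2)] assms(4) by auto
  next
    case (insert u A)
    have u: "u \<in> U" "u \<in> V" using insert.prems assms(1) by auto
    have "near {} u \<inter> ((V - U) \<union> A) \<subseteq> U - {u}" using assms(4) u(1) by (auto simp: near_def)
    then have "card (near {} u \<inter> ((V - U) \<union> A)) \<le> card (U - {u})"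
      using finU by (intro card_mono) auto
    also have "\<dots> \<le> D + 3" using assms(3) u(1) by (simp add: card_Diff_singleton)
    finally have "\<exists>c. partial (insert u ((V - U) \<union> A)) c"
      using greedy_near[OF _ u(2)] insert by auto
    then show ?case by simp
  qed
  from this[OF subset_refl finU] have "\<exists>c. partial V c" using assms(1) by (simp add: Un_absorb2)
  then show False using not_partial_V by blast
qed

section \<open>Discharging\<close>

definition bad_nbrs :: "'a \<Rightarrow> 'a set" where "bad_nbrs v = {w\<in>N v. bad w}"

definition sends :: "'a \<Rightarrow> 'a \<Rightarrow> int" where
  "sends v w = (if d v = 2 then 0 else if d w = 2 then 3 else if bad w then 1 else 0)"

text \<open>
The final charge, after all transfers; initially a vertex has \<open>7 d - 20\<close>.
\<close>
definition charge :: "'a \<Rightarrow> int" where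
  "charge v = 7 * int (d v) - 20 - (\<Sum>w\<in>N v. sends v w) + (\<Sum>w\<in>N v. sends w v)"

lemma finite_two_nbrs_bad_nbrs [simp]: "finite (two_nbrs v)" "finite (bad_nbrs v)"
  by (simp_all add: two_nbrs_def bad_nbrs_def)

lemma bad_not_2: "bad w \<Longrightarrow> d w \<noteq> 2" by (simp add: bad_def)

lemma card_two_nbrs_bad_nbrs: "card (two_nbrs v) + card (bad_nbrs v) \<le> d v"
proof -
  have "two_nbrs v \<inter> bad_nbrs v = {}" by (auto simp: two_nbrs_def bad_nbrs_def bad_def)
  then have "card (two_nbrs v) + card (bad_nbrs v) = card (two_nbrs v \<union> bad_nbrs v)" by (simp add: card_Un_disjoint)
  also have "\<dots> \<le> d v" unfolding d_def by (intro card_mono) (auto simp: two_nbrs_def bad_nbrs_def)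
  finally show ?thesis .
qed

lemma total_charge: "(\<Sum>v\<in>V. charge v) = 7 * int (\<Sum>v\<in>V. d v) - 20 * int (card V)"
proof -
  have "(\<Sum>v\<in>V. \<Sum>w\<in>N v. sends v w) = (\<Sum>w\<in>V. \<Sum>v\<in>{v\<in>V. adj v w}. sends v w)"
    unfolding N_def by (rule sum.swap_restrict[OF fin fin])
  also have "\<dots> = (\<Sum>w\<in>V. \<Sum>v\<in>N w. sends v w)"
    by (intro sum.cong) (auto simp: N_def intro: adj_sym)
  finally show ?thesis
    by (simp add: charge_def sum.distrib sum_subtractf sum_distrib_left)
qed

lemma sum_sent:
  assumes "d v \<noteq> 2"
  shows "(\<Sum>w\<in>N v. sends v w) = 3 * int (card (two_nbrs v)) + int (card (bad_nbrs v))"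
proof -
  have "(\<Sum>w\<in>N v. sends v w) = (\<Sum>w\<in>N v. (if d w = 2 then 3 else 0) + (if bad w then 1 else 0))"
    using assms by (intro sum.cong) (auto simp: sends_def bad_not_2)
  also have "\<dots> = (\<Sum>w\<in>two_nbrs v. 3) + (\<Sum>w\<in>bad_nbrs v. 1)"
    unfolding two_nbrs_def bad_nbrs_def by (simp only: sum.distrib sum.inter_filter finite_N)
  finally show ?thesis by simp
qed

lemma received_nonneg: "0 \<le> (\<Sum>w\<in>N v. sends w v)"
  by (intro sum_nonneg) (simp add: sends_def)

lemma charge_2:
  assumes "v \<in> V" "d v = 2"
  shows "charge v = 0"
proof -
  have "sends w v = 3" if "w \<in> N v" for w
    using not_adj_2_2[of v w] assms that by (auto simp: N_def sends_def)
  then have "(\<Sum>w\<in>N v. sends w v) = 3 * int (d v)" by (simp add: d_def)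
  moreover have "(\<Sum>w\<in>N v. sends v w) = 0" using assms by (simp add: sends_def)
  ultimately show ?thesis using assms by (simp add: charge_def)
qed

text \<open>
A bad vertex starts with 1, pays 3 to its only neighbour of degree 2, and receives 1 from each of the
other two, to which it pays nothing because they are not bad.
\<close>
lemma charge_bad:
  assumes "bad v"
  shows "charge v = 0"
proof -
  have v: "v \<in> V" "d v = 3" "two_nbrs v \<noteq> {}" using assms by (auto simp: bad_def)
  have "0 < card (two_nbrs v)" using v(3) by (simp add: card_gt_0_iff)
  then have t: "card (two_nbrs v) = 1" using two_nbrs_3[OF v(1,2)] by linarith
  have b: "bad_nbrs v = {}" using not_adj_bad_bad[OF assms] by (auto simp: bad_nbrs_def)
  have "(\<Sum>w\<in>N v. sends w v) = (\<Sum>w\<in>N v - two_nbrs v. sends w v)"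
    by (rule sum.mono_neutral_right) (auto simp: two_nbrs_def sends_def)
  also have "\<dots> = (\<Sum>w\<in>N v - two_nbrs v. 1)"
    using assms v by (intro sum.cong) (auto simp: two_nbrs_def sends_def)
  also have "\<dots> = 2"
    using v(2) t by (subst sum_constant, subst card_Diff_subset) (auto simp: two_nbrs_def d_def)
  finally show ?thesis using sum_sent[of v] t b v by (simp add: charge_def)
qed

lemma bad_nbrs_3: "v \<in> V \<Longrightarrow> d v = 3 \<Longrightarrow> card (bad_nbrs v) \<le> 1"
  using bad_nbr_unique[of v] by (auto simp: bad_nbrs_def card_le_Suc0_iff_eq)

lemma charge_ge:
  assumes "d v \<noteq> 2"
  shows "7 * int (d v) - 20 - 3 * int (card (two_nbrs v)) - int (card (bad_nbrs v)) \<le> charge v"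
  using sum_sent[OF assms] received_nonneg[of v] by (simp add: charge_def)

lemma charge_nonneg:
  assumes "v \<in> V"
  shows "0 \<le> charge v"
proof -
  consider "d v = 2" | "bad v" | "d v = 3" "\<not> bad v" | "d v = 4" | "5 \<le> d v"
    using min_degree[OF assms] by linarith
  then show ?thesis
  proof cases
    case 3
    then have "two_nbrs v = {}" using assms by (simp add: bad_def)
    then show ?thesis using charge_ge[of v] 3 bad_nbrs_3[OF assms] by simp
  next
    case 4
    then show ?thesis using charge_ge[of v] two_nbrs_4[OF assms] card_two_nbrs_bad_nbrs[of v] by linarith
  next
    case 5
    then show ?thesis using charge_ge[of v] card_two_nbrs_bad_nbrs[of v] by linarith
  qed (use charge_2[OF assms] charge_bad in auto)
qed

text \<open>
All final charges vanish, and the tight cases of \<open>charge_nonneg\<close> determine the graph locally.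
\<close>
lemma sparse_impossible:
  assumes sparse: "7 * (\<Sum>v\<in>V. d v) \<le> 20 * card V"
  shows False
proof -
  have "(\<Sum>v\<in>V. charge v) \<le> 0" using sparse total_charge by linarith
  then have "(\<Sum>v\<in>V. charge v) = 0" using sum_nonneg[of V charge] charge_nonneg by force
  then have zero: "charge v = 0" if "v \<in> V" for v
    using sum_nonneg_eq_0_iff[OF fin, of charge] charge_nonneg that by blast
  have deg4: "d v \<le> 4" if v: "v \<in> V" for v
  proof (rule ccontr)
    assume "\<not> d v \<le> 4"
    \<comment> \<open>A vertex of degree \<open>d v\<close> pays at most \<open>3 d v\<close>, and \<open>7 d v - 20 \<le> 3 d v\<close> leaves only \<open>d v = 5\<close> with five payments of 3.\<close>
    then have "d v = 5 \<and> card (two_nbrs v) = 5"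
      using charge_ge[of v] zero[OF v] card_two_nbrs_bad_nbrs[of v] by linarith
    then show False using two_nbrs_5[OF v] by simp
  qed
  have deg3: "d v \<le> 3" if v: "v \<in> V" for v
  proof (rule ccontr)
    assume "\<not> d v \<le> 3"
    then have d4: "d v = 4" using deg4[OF v] by linarith
    then have "card (two_nbrs v) = 2 \<and> card (bad_nbrs v) = 2"
      using charge_ge[of v] zero[OF v] card_two_nbrs_bad_nbrs[of v] two_nbrs_4[OF v] by linarith
    then obtain u u' w w' where uw: "two_nbrs v = {u, u'}" "u \<noteq> u'" "bad_nbrs v = {w, w'}" "w \<noteq> w'"
      by (auto simp: card_2_iff)
    have uN: "u \<in> N v" "u' \<in> N v" "d u = 2" "d u' = 2"
      using uw(1) unfolding two_nbrs_def by blast+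
    have wN: "w \<in> N v" "w' \<in> N v" "bad w" "bad w'"
      using uw(3) unfolding bad_nbrs_def by blast+
    have "u \<noteq> w" "u \<noteq> w'" "u' \<noteq> w" "u' \<noteq> w'" using uN(3,4) bad_not_2[OF wN(3)] bad_not_2[OF wN(4)] by auto
    then have dist: "distinct [u, u', w, w']" using uw by simp
    then have "card {u, u', w, w'} = card (N v)" using d4 by (simp add: d_def)
    then have "N v = {u, u', w, w'}" using card_subset_eq[of "N v" "{u, u', w, w'}"] uN wN by simp
    then show False
      by (rule four_vertex_reducible[OF v d4 _ dist uN(3,4) wN(3,4)])
  qed
  have deg: "d v = 2 \<or> d v = 3" if "v \<in> V" for v using min_degree[OF that] deg3[OF that] by linarith
  have bad_beside_2: "bad w" if "u \<in> V" "d u = 2" "w \<in> N u" for u w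
  proof -
    have w: "w \<in> V" "u \<in> N w" using that N_sub N_sym by blast+
    have "d w \<noteq> 2" using not_adj_2_2[of u w] that w by (auto simp: N_def)
    then have "d w = 3" using deg[OF w(1)] by blast
    then show ?thesis using w that(2) by (auto simp: bad_def two_nbrs_def)
  qed
  have has_bad: "bad_nbrs v \<noteq> {}" if v: "v \<in> V" "d v = 3" "\<not> bad v" for v
  proof
    assume "bad_nbrs v = {}"
    moreover have "two_nbrs v = {}" using v by (simp add: bad_def)
    ultimately show False using charge_ge[of v] zero[OF v(1)] v(2) by simp
  qed
  have "V \<noteq> {}" using not_partial_V by (auto simp: partial_iff)
  then obtain v0 where v0: "v0 \<in> V" by blast
  obtain u where u: "u \<in> V" "d u = 2"
  proof -
    have "\<exists>w. bad w" if "d v0 = 3"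
      using has_bad[OF v0 that] by (cases "bad v0") (auto simp: bad_nbrs_def)
    then obtain u where "u \<in> V" "d u = 2"
      using deg[OF v0] v0 N_sub unfolding bad_def two_nbrs_def by blast
    then show ?thesis by (rule that)
  qed
  have "N u \<noteq> {}" using u(2) by (auto simp: d_def)
  then obtain v where vu: "v \<in> N u" by blast
  obtain x where x: "N u = {v, x}" "x \<noteq> v" by (rule nbrs_2[OF u(2) vu])
  have Nbad: "bad y" "u \<in> N y" "d y = 3" if "y \<in> N u" for y
    using bad_beside_2[OF u that] N_sym[OF u(1) that] by (auto simp: bad_def)
  \<comment> \<open>This set also contains \<open>u\<close>: it consists of all vertices within distance two of \<open>u\<close>.\<close>
  let ?B = "N u \<union> N v \<union> N x"
  have BV: "?B \<subseteq> V" using N_sub by blast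
  have uB: "u \<in> ?B" using Nbad(2)[of v] vu by blast
  have D3: "3 \<le> D" using d_le[of v] Nbad(3)[OF vu] vu N_sub by fastforce
  \<comment> \<open>The vertices \<open>v\<close> and \<open>x\<close> have \<open>u\<close> as a common neighbour and two further ones each: \<open>3 + 2 + 2 = 7\<close>.\<close>
  have cardB: "card ?B \<le> D + 4"
  proof -
    have "?B \<subseteq> {v, x, u} \<union> ((N v - {u}) \<union> (N x - {u}))" using x(1) by auto
    then have "card ?B \<le> card ({v, x, u} \<union> ((N v - {u}) \<union> (N x - {u})))" by (intro card_mono) auto
    also have "\<dots> \<le> card {v, x, u} + card ((N v - {u}) \<union> (N x - {u}))" by (rule card_Un_le)
    also have "card ((N v - {u}) \<union> (N x - {u})) \<le> card (N v - {u}) + card (N x - {u})" by (rule card_Un_le)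
    also have "card (N v - {u}) = 2" using Nbad(2,3)[of v] x(1) by (simp add: d_def card_Diff_singleton)
    also have "card (N x - {u}) = 2" using Nbad(2,3)[of x] x(1) by (simp add: d_def card_Diff_singleton)
    also have "card {v, x, u} \<le> 3" using card_length[of "[v, x, u]"] by simp
    finally show ?thesis using D3 by simp
  qed
  have "\<exists>a\<in>?B. \<not> N a \<subseteq> ?B"
    using small_component_reducible[OF BV _ cardB] uB by blast
  then obtain a p where a: "a \<in> ?B" "p \<in> N a" "p \<notin> ?B" by blast
  have NB: "N y \<subseteq> ?B" if "y \<in> N u" for y using that x(1) by auto
  have "a \<notin> N u" "a \<noteq> u" using a NB[of a] by auto
  then obtain y where y: "y \<in> N u" "a \<in> N y" using a(1) x(1) by auto
  have aV: "a \<in> V" "p \<in> V" "y \<in> V" "y \<in> N a" using a y N_sub N_sym by blast+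
  note yb = Nbad[OF y(1)]
  have da: "d a \<noteq> 2"
  proof
    assume "d a = 2"
    then have "{a, u} \<subseteq> two_nbrs y" using y(2) yb(2) u(2) by (auto simp: two_nbrs_def)
    then have "card {a, u} \<le> card (two_nbrs y)" by (intro card_mono) auto
    then show False using two_nbrs_3[OF aV(3) yb(3)] \<open>a \<noteq> u\<close> by simp
  qed
  then have da3: "d a = 3" using deg[OF aV(1)] by blast
  have nba: "\<not> bad a" using not_adj_bad_bad[OF yb(1)] y(2) by blast
  then have "two_nbrs a = {}" using aV da3 by (simp add: bad_def)
  then have "d p \<noteq> 2" using a(2) by (auto simp: two_nbrs_def)
  then have dp3: "d p = 3" using deg[OF aV(2)] by blast
  have nbp: "\<not> bad p"
  proof
    assume "bad p"
    then have "p = y" using bad_nbr_unique[OF aV(1) da3 a(2) aV(4)] yb(1) by blast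
    then show False using y(1) a(3) by blast
  qed
  obtain v' where v': "v' \<in> N p" "bad v'" using has_bad[OF aV(2) dp3 nbp] by (auto simp: bad_nbrs_def)
  have pv': "p \<in> N v'" using v'(1) N_sym[OF aV(2)] by blast
  have v'u: "v' \<notin> N u" using NB[of v'] pv' a(3) by blast
  have v'V: "v' \<in> V" "d v' = 3" using v'(2) by (auto simp: bad_def)
  \<comment> \<open>A common neighbour would be a second neighbour of degree 2 of \<open>y\<close>, or a 3-vertex with two bad neighbours.\<close>
  have "N y \<inter> N v' = {}"
  proof (rule ccontr)
    assume "N y \<inter> N v' \<noteq> {}"
    then obtain z where z: "z \<in> N y" "z \<in> N v'" by blast
    have zV: "z \<in> V" "y \<in> N z" "v' \<in> N z" using z N_sub N_sym aV(3) v'V(1) by blast+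
    show False
    proof (cases "d z = 2")
      case True
      have "z \<noteq> u" using zV(3) v'u by blast
      have "{z, u} \<subseteq> two_nbrs y" using True z(1) yb(2) u(2) by (auto simp: two_nbrs_def)
      then have "card {z, u} \<le> card (two_nbrs y)" by (intro card_mono) auto
      then show False using two_nbrs_3[OF aV(3) yb(3)] \<open>z \<noteq> u\<close> by simp
    next
      case False
      then have "d z = 3" using deg[OF zV(1)] by blast
      then have "y = v'" using bad_nbr_unique[OF zV(1) _ zV(2,3)] yb(1) v'(2) by blast
      then show False using v'u y(1) by blast
    qed
  qed
  then show False
    using path_reducible[OF deg3 yb(1) v'(2) y(2) da3 nba pv' dp3 nbp a(2)] by blast
qed

end

section \<open>From maximum average degree to minimal counterexamples\<close>

text \<open>
Density and degree bounds pass to induced subgraphs, so a smallest counterexample is a critical graph.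
\<close>
lemma sparse_colorable:
  fixes adj :: "'a \<Rightarrow> 'a \<Rightarrow> bool"
  assumes "finite V" and sym: "\<And>u v. adj u v \<Longrightarrow> adj v u" and irrefl: "\<And>v. \<not> adj v v"
    and "\<And>v. v \<in> V \<Longrightarrow> card {u\<in>V. adj v u} \<le> D"
    and "\<And>S. S \<subseteq> V \<Longrightarrow> 7 * (\<Sum>v\<in>S. card {u\<in>S. adj v u}) \<le> 20 * card S"
  shows "\<exists>c. partial_coloring adj (D + 4) V V c"
  using assms(1,4,5)
proof (induction V rule: finite_psubset_induct)
  case (psubset V)
  show ?case
  proof (rule ccontr)
    assume no: "\<not> ?case"
    interpret critical_graph V adj D
    proof
      fix U assume U: "U \<subseteq> V" "U \<noteq> {}"
      show "\<exists>c. partial_coloring adj (D + 4) (V - U) (V - U) c"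
      proof (rule psubset.IH)
        show "V - U \<subset> V" using U by blast
        fix v assume v: "v \<in> V - U"
        have "card {u \<in> V - U. adj v u} \<le> card {u \<in> V. adj v u}"
          using psubset.hyps by (intro card_mono) auto
        then show "card {u \<in> V - U. adj v u} \<le> D" using psubset.prems(1)[of v] v by simp
      next
        fix S assume "S \<subseteq> V - U"
        then show "7 * (\<Sum>v\<in>S. card {u\<in>S. adj v u}) \<le> 20 * card S"
          using psubset.prems(2)[of S] by blast
      qed
    qed (use psubset.hyps psubset.prems(1) sym irrefl no in auto)
    show False
      by (rule sparse_impossible) (use psubset.prems(2)[of V] in \<open>simp add: d_def N_def\<close>)
  qed
qed

lemma handshake:
  assumes "pair_graph H"
  shows "2 * card (edges H) = card (parcs H)"
proof -
  interpret pair_graph H by fact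
  let ?f = "\<lambda>(u, v). {u, v}"
  have edges: "edges H = ?f ` parcs H" by (auto simp: edges_def)
  have fin: "finite (parcs H)" by (rule pair_finite_arcs)
  have "card {e \<in> parcs H. ?f e = E} = 2" if "E \<in> edges H" for E
  proof -
    obtain u v where uv: "(u, v) \<in> parcs H" "E = {u, v}" using \<open>E \<in> edges H\<close> by (auto simp: edges_def)
    have vu: "(v, u) \<in> parcs H" using uv(1) by (rule arcs_symmetric)
    have ne: "u \<noteq> v" using pair_no_loops[OF uv(1)] by simp
    have "{e \<in> parcs H. ?f e = E} = {(u, v), (v, u)}"
    proof (rule set_eqI)
      fix e
      show "e \<in> {e \<in> parcs H. ?f e = E} \<longleftrightarrow> e \<in> {(u, v), (v, u)}"
        using uv(1) vu by (cases e) (simp only: uv(2) mem_Collect_eq insert_iff prod.case doubleton_eq_iff prod.inject empty_iff, metis)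
    qed
    then show ?thesis using ne by simp
  qed
  then have "card (parcs H) = (\<Sum>E\<in>edges H. 2)"
    using sum.image_gen[OF fin, of "\<lambda>_. 1::nat" ?f] unfolding edges by simp
  then show ?thesis by simp
qed

text \<open>
The maximum defining \<open>mad\<close> includes the induced subgraphs, which is all that the argument uses.
\<close>
lemma degree_sum_le_mad:
  assumes "pair_graph G" and S: "S \<subseteq> pverts G" "S \<noteq> {}"
  shows "real (\<Sum>v\<in>S. card {u\<in>S. (v, u) \<in> parcs G}) / real (card S) \<le> mad G"
proof -
  interpret pair_graph G by fact
  let ?H = "\<lparr>pverts = S, parcs = {(v, u) \<in> parcs G. v \<in> S \<and> u \<in> S}\<rparr>"
  have finS: "finite S" using S(1) pair_finite_verts finite_subset by blast
  have fin: "finite (parcs ?H)" using pair_finite_arcs by (auto intro: finite_subset[of _ "parcs G"])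
  have H: "pair_graph ?H"
  proof
    show "fst e \<noteq> snd e" if "e \<in> parcs ?H" for e using pair_no_loops[of e] that by auto
    show "symmetric ?H" using arcs_symmetric by (auto simp: symmetric_def sym_def)
  qed (use finS fin in auto)
  interpret H: pair_graph ?H by (rule H)
  have sub: "subgraph ?H G"
    using S(1) wf_digraph H.wf_digraph by (auto simp: subgraph_def)
  have "parcs ?H = (SIGMA v:S. {u\<in>S. (v, u) \<in> parcs G})" by auto
  then have "card (parcs ?H) = (\<Sum>v\<in>S. card {u\<in>S. (v, u) \<in> parcs G})"
    using finS by (simp add: card_SigmaI)
  then have e: "2 * card (edges ?H) = (\<Sum>v\<in>S. card {u\<in>S. (v, u) \<in> parcs G})"
    using handshake[OF H] by simp
  have "2 * real (card (edges ?H)) / real (card (pverts ?H)) \<le> mad G"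
    unfolding mad_def
  proof (rule Max_ge[OF finite_mad_set], rule CollectI, rule exI[of _ ?H], intro conjI refl)
    show "pair_graph ?H" by (rule H)
    show "subgraph ?H G" by (rule sub)
    show "pverts ?H \<noteq> {}" using S(2) by simp
  qed
  moreover have "2 * real (card (edges ?H)) = real (\<Sum>v\<in>S. card {u\<in>S. (v, u) \<in> parcs G})"
    unfolding e[symmetric] by simp
  ultimately show ?thesis by simp
qed

theorem theorem1p2:
  fixes G :: "'a pair_pre_digraph"
  assumes "pair_graph G"
    and "mad G \<le> 20 / 7"
  shows "strong_odd_chromatic_number G \<le> max_degree G + 4"
proof -
  interpret pair_graph G by fact
  let ?adj = "\<lambda>u v. (u, v) \<in> parcs G" and ?D = "max_degree G"
  have nbrs: "nbrs G v = {u \<in> pverts G. ?adj v u}" for v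
    by (auto simp: nbrs_def dest: in_arcsD2)
  have "\<exists>c. partial_coloring ?adj (?D + 4) (pverts G) (pverts G) c"
  proof (rule sparse_colorable)
    show "finite (pverts G)" by (rule pair_finite_verts)
    show "?adj v u" if "?adj u v" for u v using that by (rule arcs_symmetric)
    show "\<not> ?adj v v" for v using pair_no_loops[of "(v, v)"] by auto
    show "card {u \<in> pverts G. ?adj v u} \<le> ?D" if "v \<in> pverts G" for v
      unfolding max_degree_def nbrs[symmetric] using that pair_finite_verts by (intro Max_ge) auto
    show "7 * (\<Sum>v\<in>S. card {u\<in>S. ?adj v u}) \<le> 20 * card S" if S: "S \<subseteq> pverts G" for S
    proof (cases "S = {}")
      case False
      have "0 < card S" using False finite_subset[OF S pair_finite_verts] by (simp add: card_gt_0_iff)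
      then have "real (\<Sum>v\<in>S. card {u\<in>S. ?adj v u}) \<le> 20 / 7 * real (card S)"
        using order.trans[OF degree_sum_le_mad[OF assms(1) S False] assms(2)] by (simp add: divide_le_eq)
      then have "real (7 * (\<Sum>v\<in>S. card {u\<in>S. ?adj v u})) \<le> real (20 * card S)" by simp
      then show ?thesis by linarith
    qed simp
  qed
  then obtain c where c: "partial_coloring ?adj (?D + 4) (pverts G) (pverts G) c" by blast
  have "c u \<noteq> c v" if "?adj u v" for u v
    using c that in_arcsD1[OF that] in_arcsD2[OF that] by (simp add: partial_coloring_def)
  then have "strong_odd_coloring G (?D + 4) c"
    using c by (auto simp: strong_odd_coloring_def proper_coloring_def partial_coloring_def odd_on_def nbrs)
  then show ?thesis
    unfolding strong_odd_chromatic_number_def by (intro Least_le) auto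
qed

end
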